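(* Let $L$ be a positive-definite, odd, integral lattice of minimum norm $2$ with $V_L$ the corresponding super vertex operator algebra. Let $V\subseteq V_L$ be the subalgebra generated by $4$ vectors of weight $\frac32$, so that $$V=\mathbb{C}\mathbf 1\oplus V_1\oplus V_{\frac32}\oplus\cdots,$$ and assume that the following hold: (I) the subspace of $V_{\frac32}$ spanned by the four generators decomposes as $A\oplus B$, a pair of $2$-dimensional vector representations for $\mathfrak{sl}_2$, where (II) $A(1)B\cong\mathfrak{sl}_2$ (this is the $\mathfrak{sl}_2$ referred to in (I) and (IV)); (III) $A(1)A=B(1)B=0$; (IV) $\mathfrak{sl}_2$ contains a root of $L$. Then $V\cong\mathcal{A}_{N=4}$ with central charge $c=6$.
   Context: **Lattice SVOA.** The norm of $\alpha\in L$ is $(\alpha,\alpha)$; a root of $L$ is a vector of norm $2$. $V_L=M(1)\otimes\mathbb{C}^\varepsilon[L]$ is the standard lattice super vertex operator algebra, where $M(1)$ is the rank-$\mathrm{rk}\,L$ Heisenberg Fock space on $\mathfrak h=\mathbb{C}\otimes_{\mathbb Z}L$, and $\mathbb{C}^\varepsilon[L]$ has basis $e^\alpha$ ($\alpha\in L$) with $e^\alpha e^\beta=\varepsilon(\alpha,\beta)e^{\alpha+\beta}$; here $\varepsilon:L\times L\to\{\pm1\}$ is bimultiplicative with $\varepsilon(\alpha,\beta)\varepsilon(\beta,\alpha)=(-1)^{(\alpha,\beta)+(\alpha,\alpha)(\beta,\beta)}$ and $\varepsilon(\alpha,\alpha)=(-1)^{((\alpha,\alpha)+(\alpha,\alpha)^2)/2}$.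 The weight of $e^\alpha$ is $\frac12(\alpha,\alpha)$; parity of a weight-$k$ state is $2k\bmod2$; the Virasoro element is $\frac12\sum_ih_i(-1)h_i$ for any orthonormal basis $\{h_i\}$ of $\mathfrak h$. An element $\alpha\in\mathfrak h$ is identified with the weight-one state $\alpha(-1)\mathbf 1$; thus (IV) means that $\alpha(-1)\mathbf 1\in A(1)B$ for some $\alpha\in L$ with $(\alpha,\alpha)=2$. **Notation.** $Y(u,z)=\sum_n u(n)z^{-n-1}$; $Tu=u(-2)\mathbf 1$. For subsets $X,Y$ and $n\in\mathbb{Z}$, $X(n)Y$ is the linear span of all $u(n)v$, $u\in X$, $v\in Y$. $A(1)B\subseteq V_1$ is a Lie algebra under $[u,v]=u(0)v$, acting on states by $u\mapsto u(0)$. "Vector representation" means the $2$-dimensional irreducible $\mathfrak{sl}_2$-module. The subalgebra generated by a set of states is the span of all iterated mode products of them applied to $\mathbf 1$. **The $N=4$ algebra.** $V\cong\mathcal{A}_{N=4}$ with central charge $c$ means that $V$ is generated by four states $G^\pm,\overline G^\pm$ of weight $\frac32$ for which there are weight-one states $J^\pm,J^0$ and a Virasoro element $\omega$ of central charge $c$ satisfying (a) $J^0(0)J^\pm=\pm2J^\pm$; (b) $J^0(1)J^0=\frac c3\mathbf 1$; (c) $J^+(0)J^-=J^0$; (d) $J^+(1)J^-=\frac c6\mathbf 1$; (e) $J^0(0)G^\pm=\pm G^\pm$; (f) $J^0(0)\overline G^\pm=\pm\overline G^\pm$; (g) $J^\pm(0)G^\mp=G^\pm$; (h) $J^\pm(0)\overline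 G^\mp=-\overline G^\pm$; (i) $G^\pm(1)\overline G^\pm=2J^\pm$; (j) $G^\pm(1)\overline G^\mp=\pm J^0$; (k) $G^\pm(2)\overline G^\mp=\frac c3\mathbf 1$; (l) $G^\pm(0)\overline G^\pm=TJ^\pm$; (m) $G^\pm(0)\overline G^\mp=\omega\pm\frac12TJ^0$; together with the usual Virasoro relations ($J^\pm,J^0$ are primary of weight $1$ and $G^\pm,\overline G^\pm$ primary of weight $\frac32$ with respect to $\omega$), and all products $u(n)v$, $n\ge0$, of the states $G^\pm,\overline G^\pm,J^\pm,J^0,\omega$ not determined by the relations (a)–(m) and these Virasoro relations (directly or via super skew-symmetry) are zero; in particular $G(n)G=\overline G(n)\overline G=0$ for all $n\ge 0$, $J^\pm(0)G^\pm=J^\pm(0)\overline G^\pm=0$, $J(n)G=J(n)\overline G=0$ for $n\ge1$, and $G^\pm(2)\overline G^\pm=0$. *)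

theory Defs
  imports "HOL-Analysis.Analysis" "HOL-Library.Multiset" "HOL-Library.Groups_Big_Fun"
begin

section \<open>Positive-definite integral lattices\<close>

text \<open>
  A positive-definite lattice of rank \<open>r\<close> is given inside the Euclidean space
  \<open>\<real> \<otimes> L\<close>, so it always spans the ambient space and \<open>r = DIM('a)\<close>; the bilinear form is the
  inner product. A free type \<open>'a\<close> ranges over all ranks \<open>r \<ge> 1\<close> (an odd lattice is nonzero).
\<close>

definition pd_lattice :: "'a::euclidean_space set \<Rightarrow> bool" where
  "pd_lattice L \<longleftrightarrow> (\<exists>B. independent B \<and> span B = UNIV \<and>
     L = range (\<lambda>k::'a \<Rightarrow> int. \<Sum>b\<in>B. of_int (k b) *\<^sub>R b))"

definition integral_lattice :: "'a::euclidean_space set \<Rightarrow> bool" where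
  "integral_lattice L \<longleftrightarrow> (\<forall>\<alpha>\<in>L. \<forall>\<beta>\<in>L. \<alpha> \<bullet> \<beta> \<in> \<int>)"

definition odd_lattice :: "'a::euclidean_space set \<Rightarrow> bool" where
  "odd_lattice L \<longleftrightarrow> (\<exists>\<alpha>\<in>L. \<exists>k::int. odd k \<and> \<alpha> \<bullet> \<alpha> = of_int k)"

definition min_norm :: "'a::euclidean_space set \<Rightarrow> real \<Rightarrow> bool" where
  "min_norm L d \<longleftrightarrow> (\<exists>\<alpha>\<in>L - {0}. \<alpha> \<bullet> \<alpha> = d) \<and> (\<forall>\<alpha>\<in>L - {0}. d \<le> \<alpha> \<bullet> \<alpha>)"

text \<open>The inner product as an integer; only meaningful on an integral lattice.\<close>

definition lip :: "'a::euclidean_space \<Rightarrow> 'a \<Rightarrow> int" where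
  "lip \<alpha> \<beta> = \<lfloor>\<alpha> \<bullet> \<beta>\<rfloor>"

definition lattice_cocycle :: "'a::euclidean_space set \<Rightarrow> ('a \<Rightarrow> 'a \<Rightarrow> complex) \<Rightarrow> bool" where
  "lattice_cocycle L \<epsilon> \<longleftrightarrow>
     (\<forall>\<alpha>\<in>L. \<forall>\<beta>\<in>L. \<epsilon> \<alpha> \<beta> \<in> {1, -1}) \<and>
     (\<forall>\<alpha>\<in>L. \<forall>\<beta>\<in>L. \<forall>\<gamma>\<in>L. \<epsilon> (\<alpha> + \<beta>) \<gamma> = \<epsilon> \<alpha> \<gamma> * \<epsilon> \<beta> \<gamma>) \<and>
     (\<forall>\<alpha>\<in>L. \<forall>\<beta>\<in>L. \<forall>\<gamma>\<in>L. \<epsilon> \<alpha> (\<beta> + \<gamma>) = \<epsilon> \<alpha> \<beta> * \<epsilon> \<alpha> \<gamma>) \<and>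
     (\<forall>\<alpha>\<in>L. \<forall>\<beta>\<in>L. \<epsilon> \<alpha> \<beta> * \<epsilon> \<beta> \<alpha> = (-1) powi (lip \<alpha> \<beta> + lip \<alpha> \<alpha> * lip \<beta> \<beta>)) \<and>
     (\<forall>\<alpha>\<in>L. \<epsilon> \<alpha> \<alpha> = (-1) powi ((lip \<alpha> \<alpha> + (lip \<alpha> \<alpha>)\<^sup>2) div 2))"


section \<open>Super vertex operator algebras\<close>

text \<open>
  \<open>wt V k\<close> is the space \<open>V\<^sub>k\<close> of states of weight \<open>k\<close>, and \<open>mode V u n v\<close> is \<open>u(n)v\<close>, where
  \<open>Y(u,z) = \<Sum>\<^sub>n u(n) z\<^sup>-\<^sup>n\<^sup>-\<^sup>1\<close>. The underlying space is all of the type \<open>'v\<close>.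
\<close>

record 'v svoa =
  smult :: "complex \<Rightarrow> 'v \<Rightarrow> 'v"
  wt :: "real \<Rightarrow> 'v set"
  mode :: "'v \<Rightarrow> int \<Rightarrow> 'v \<Rightarrow> 'v"  ("_\<langle>_\<rangle>\<index> _" [80, 0, 80] 80)
  vac :: 'v  ("\<one>\<index>")
  conf :: 'v  ("\<omega>\<index>")

abbreviation vspan :: "'v::ab_group_add svoa \<Rightarrow> 'v set \<Rightarrow> 'v set" where
  "vspan V \<equiv> module.span (smult V)"

abbreviation vsubspace :: "'v::ab_group_add svoa \<Rightarrow> 'v set \<Rightarrow> bool" where
  "vsubspace V \<equiv> module.subspace (smult V)"

abbreviation vdim :: "'v::ab_group_add svoa \<Rightarrow> 'v set \<Rightarrow> nat" where
  "vdim V \<equiv> vector_space.dim (smult V)"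

text \<open>
  The sums in the Borcherds identity have finitely many nonzero terms by truncation.
  States of weight \<open>p/2\<close> have parity \<open>p mod 2\<close>. Directness of the sum of the weight spaces
  follows from \<open>L0\<close>, where \<open>L(n) = \<omega>(n+1)\<close>.
\<close>

locale super_voa =
  fixes V :: "'v::ab_group_add svoa" (structure) and c :: complex
  assumes vector_space: "vector_space (smult V)"
    and mode_add_left: "(u + u')\<langle>n\<rangle> v = u\<langle>n\<rangle> v + u'\<langle>n\<rangle> v"
    and mode_scale_left: "(smult V a u)\<langle>n\<rangle> v = smult V a (u\<langle>n\<rangle> v)"
    and mode_add_right: "u\<langle>n\<rangle> (v + v') = u\<langle>n\<rangle> v + u\<langle>n\<rangle> v'"
    and mode_scale_right: "u\<langle>n\<rangle> (smult V a v) = smult V a (u\<langle>n\<rangle> v)"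
    and truncation: "\<exists>N. \<forall>n\<ge>N. u\<langle>n\<rangle> v = 0"
    and vacuum: "\<one>\<langle>n\<rangle> v = (if n = -1 then v else 0)"
    and creation: "u\<langle>-1\<rangle> \<one> = u" "n \<ge> 0 \<Longrightarrow> u\<langle>n\<rangle> \<one> = 0"
    and wt_subspace: "vsubspace V (wt V k)"
    and wt_half_integral: "2 * k \<notin> \<int> \<Longrightarrow> wt V k = {0}"
    and wt_bounded_below: "\<exists>K. \<forall>k<K. wt V k = {0}"
    and wt_finite_dim: "\<exists>F. finite F \<and> wt V k = vspan V F"
    and wt_span: "vspan V (\<Union>k. wt V k) = UNIV"
    and vac_wt: "\<one> \<in> wt V 0"
    and conf_wt: "\<omega> \<in> wt V 2"
    and mode_wt: "u \<in> wt V k \<Longrightarrow> v \<in> wt V l \<Longrightarrow> u\<langle>n\<rangle> v \<in> wt V (k + l - of_int n - 1)"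
    and borcherds: "u \<in> wt V (of_int p / 2) \<Longrightarrow> v \<in> wt V (of_int q / 2) \<Longrightarrow>
      Sum_any (\<lambda>j. smult V (of_int m gchoose j) ((u\<langle>l + int j\<rangle> v)\<langle>m + n - int j\<rangle> w)) =
      Sum_any (\<lambda>j. smult V ((-1) ^ j * (of_int l gchoose j))
        (u\<langle>m + l - int j\<rangle> (v\<langle>n + int j\<rangle> w)
          - smult V ((-1) powi (l + p * q)) (v\<langle>n + l - int j\<rangle> (u\<langle>m + int j\<rangle> w))))"
    and virasoro: "\<omega>\<langle>m + 1\<rangle> (\<omega>\<langle>n + 1\<rangle> v) - \<omega>\<langle>n + 1\<rangle> (\<omega>\<langle>m + 1\<rangle> v) =
      smult V (of_int (m - n)) (\<omega>\<langle>m + n + 1\<rangle> v)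
        + (if m + n = 0 then smult V (of_int (m ^ 3 - m) / 12 * c) v else 0)"
    and L0: "v \<in> wt V k \<Longrightarrow> \<omega>\<langle>1\<rangle> v = smult V (of_real k) v"
    and Lminus1: "\<omega>\<langle>0\<rangle> v = v\<langle>-2\<rangle> \<one>"

text \<open>\<open>X(n)Y\<close>.\<close>

definition mode_prod :: "'v::ab_group_add svoa \<Rightarrow> 'v set \<Rightarrow> int \<Rightarrow> 'v set \<Rightarrow> 'v set" where
  "mode_prod V X n Y = vspan V {mode V u n v | u v. u \<in> X \<and> v \<in> Y}"

inductive_set mode_words :: "'v svoa \<Rightarrow> 'v set \<Rightarrow> 'v set"
  for V (structure) and S where
  vac_word: "\<one> \<in> mode_words V S"
| step_word: "u \<in> S \<Longrightarrow> x \<in> mode_words V S \<Longrightarrow> u\<langle>n\<rangle> x \<in> mode_words V S"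

definition generated :: "'v::ab_group_add svoa \<Rightarrow> 'v set \<Rightarrow> 'v set" where
  "generated V S = vspan V (mode_words V S)"

definition direct_sum :: "'v::ab_group_add svoa \<Rightarrow> 'v set \<Rightarrow> 'v set \<Rightarrow> 'v set \<Rightarrow> bool" where
  "direct_sum V U A B \<longleftrightarrow> vsubspace V A \<and> vsubspace V B \<and> A \<inter> B = {0} \<and>
     U = {a + b | a b. a \<in> A \<and> b \<in> B}"


section \<open>Lattice super vertex operator algebras\<close>

text \<open>
  The state \<open>e m \<alpha>\<close> stands for \<open>(\<Prod>(i,n)\<in>#m. h\<^sub>i(-n)) e\<^sup>\<alpha>\<close>, where \<open>h\<^sub>i = i\<close> runs through the
  orthonormal basis \<open>Basis\<close>; thus the \<open>e m \<alpha>\<close> with \<open>(m, \<alpha>)\<close> in \<open>fock_labels L\<close> are the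
  monomial basis of \<open>M(1) \<otimes> \<complex>[L]\<close>.
\<close>

definition fock_labels :: "'a::euclidean_space set \<Rightarrow> (('a \<times> nat) multiset \<times> 'a) set" where
  "fock_labels L = {(m, \<alpha>). set_mset m \<subseteq> Basis \<times> {1..} \<and> \<alpha> \<in> L}"

definition label_wt :: "('a::euclidean_space \<times> nat) multiset \<Rightarrow> 'a \<Rightarrow> real" where
  "label_wt m \<alpha> = real (\<Sum>x\<in>#m. snd x) + (\<alpha> \<bullet> \<alpha>) / 2"

text \<open>The weight-one state \<open>\<alpha>(-1)\<one>\<close>.\<close>

definition hstate :: "'v::ab_group_add svoa \<Rightarrow> (('a::euclidean_space \<times> nat) multiset \<Rightarrow> 'a \<Rightarrow> 'v) \<Rightarrow> 'a \<Rightarrow> 'v"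
  where "hstate V e \<alpha> = (\<Sum>i\<in>Basis. smult V (of_real (\<alpha> \<bullet> i)) (e {#(i, 1)#} 0))"

text \<open>
  \<open>exp_minus V e \<alpha> k\<close> is the coefficient of \<open>z\<^sup>k\<close> in \<open>exp (\<Sum>\<^sub>n\<^sub>\<ge>\<^sub>1 \<alpha>(-n) z\<^sup>n / n)\<close> and
  \<open>exp_plus V e \<alpha> k\<close> is the coefficient of \<open>z\<^sup>-\<^sup>k\<close> in \<open>exp (- \<Sum>\<^sub>n\<^sub>\<ge>\<^sub>1 \<alpha>(n) z\<^sup>-\<^sup>n / n)\<close>,
  computed by logarithmic differentiation: \<open>k S\<^sub>k = \<Sum>\<^sub>1\<^sub>\<le>\<^sub>j\<^sub>\<le>\<^sub>k \<alpha>(-j) S\<^sub>k\<^sub>-\<^sub>j\<close> and similarly for the other one.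
\<close>

fun exp_minus :: "'v::ab_group_add svoa \<Rightarrow> (('a::euclidean_space \<times> nat) multiset \<Rightarrow> 'a \<Rightarrow> 'v) \<Rightarrow>
    'a \<Rightarrow> nat \<Rightarrow> 'v \<Rightarrow> 'v" where
  "exp_minus V e \<alpha> 0 v = v"
| "exp_minus V e \<alpha> (Suc k) v = smult V (1 / of_nat (Suc k))
     (\<Sum>j\<le>k. mode V (hstate V e \<alpha>) (- int (Suc j)) (exp_minus V e \<alpha> (k - j) v))"

fun exp_plus :: "'v::ab_group_add svoa \<Rightarrow> (('a::euclidean_space \<times> nat) multiset \<Rightarrow> 'a \<Rightarrow> 'v) \<Rightarrow>
    'a \<Rightarrow> nat \<Rightarrow> 'v \<Rightarrow> 'v" where
  "exp_plus V e \<alpha> 0 v = v"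
| "exp_plus V e \<alpha> (Suc k) v = smult V (- 1 / of_nat (Suc k))
     (\<Sum>j\<le>k. mode V (hstate V e \<alpha>) (int (Suc j)) (exp_plus V e \<alpha> (k - j) v))"

text \<open>
  \<open>V\<close> is \<open>V\<^sub>L\<close>: the super vertex operator algebra structure on \<open>M(1) \<otimes> \<complex>\<^sup>\<epsilon>[L]\<close>, of central charge
  \<open>rk L\<close>, with \<open>Y(h(-1)\<one>,z) = \<Sum>\<^sub>n h(n) z\<^sup>-\<^sup>n\<^sup>-\<^sup>1\<close>, where \<open>h(n)\<close> are the operators of the
  Heisenberg algebra, and
  \<open>Y(e\<^sup>\<alpha>,z) = exp (\<Sum>\<^sub>n\<^sub>\<ge>\<^sub>1 \<alpha>(-n) z\<^sup>n / n) exp (- \<Sum>\<^sub>n\<^sub>\<ge>\<^sub>1 \<alpha>(n) z\<^sup>-\<^sup>n / n) e\<^sup>\<alpha> z\<^sup>\<alpha>\<close>, where \<open>e\<^sup>\<alpha>\<close> acts by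
  multiplication in \<open>\<complex>\<^sup>\<epsilon>[L]\<close>. The states \<open>h(-1)\<one>\<close> and \<open>e\<^sup>\<alpha>\<close> generate \<open>V\<^sub>L\<close>, so all of \<open>Y\<close> is
  determined by these fields. In \<open>exp_mode\<close>, \<open>l\<close> is the exponent taken from the
  second exponential and only finitely many \<open>l\<close> contribute.
\<close>

locale lattice_svoa = super_voa V "of_nat DIM('a::euclidean_space)"
  for V :: "'v::ab_group_add svoa" (structure) +
  fixes L :: "'a::euclidean_space set"
    and \<epsilon> :: "'a \<Rightarrow> 'a \<Rightarrow> complex"
    and e :: "('a \<times> nat) multiset \<Rightarrow> 'a \<Rightarrow> 'v"
  assumes basis_inj: "inj_on (case_prod e) (fock_labels L)"
    and basis_indep: "\<not> module.dependent (smult V) (case_prod e ` fock_labels L)"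
    and basis_span: "vspan V (case_prod e ` fock_labels L) = UNIV"
    and wt_eq: "wt V k = vspan V {e m \<alpha> | m \<alpha>. (m, \<alpha>) \<in> fock_labels L \<and> label_wt m \<alpha> = k}"
    and vac_eq: "\<one> = e {#} 0"
    and conf_eq: "\<omega> = smult V (1/2) (\<Sum>i\<in>Basis. e {#(i, 1), (i, 1)#} 0)"
    and heisenberg_mode: "i \<in> Basis \<Longrightarrow> (m, \<beta>) \<in> fock_labels L \<Longrightarrow>
      (e {#(i, 1)#} 0)\<langle>n\<rangle> (e m \<beta>) =
        (if n < 0 then e (add_mset (i, nat (-n)) m) \<beta>
         else if n = 0 then smult V (of_real (\<beta> \<bullet> i)) (e m \<beta>)
         else smult V (of_int n * of_nat (count m (i, nat n))) (e (m - {#(i, nat n)#}) \<beta>))"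
    and exp_mode: "\<alpha> \<in> L \<Longrightarrow> (m, \<beta>) \<in> fock_labels L \<Longrightarrow>
      (e {#} \<alpha>)\<langle>n\<rangle> (e m \<beta>) =
        Sum_any (\<lambda>l. let k = int l - lip \<alpha> \<beta> - n - 1 in
          if k < 0 then 0
          else smult V (\<epsilon> \<alpha> \<beta>) (exp_minus V e \<alpha> (nat k) (exp_plus V e \<alpha> l (e m (\<alpha> + \<beta>)))))"


section \<open>The Lie algebra \<open>sl\<^sub>2\<close> and its vector representation\<close>

definition sl2 :: "(complex^2^2) set" where
  "sl2 = {X. trace X = 0}"

text \<open>
  \<open>W\<close> with the product \<open>u(0)v\<close> is isomorphic to \<open>sl\<^sub>2\<close> as a Lie algebra; in particular
  it is closed under this product.
\<close>

definition iso_sl2 :: "'v::ab_group_add svoa \<Rightarrow> 'v set \<Rightarrow> bool" where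
  "iso_sl2 V W \<longleftrightarrow> (\<exists>\<phi>. bij_betw \<phi> sl2 W \<and>
     (\<forall>X\<in>sl2. \<forall>Y\<in>sl2. \<phi> (X + Y) = \<phi> X + \<phi> Y) \<and>
     (\<forall>a. \<forall>X\<in>sl2. \<phi> (\<chi> i j. a * X $ i $ j) = smult V a (\<phi> X)) \<and>
     (\<forall>X\<in>sl2. \<forall>Y\<in>sl2. \<phi> (X ** Y - Y ** X) = mode V (\<phi> X) 0 (\<phi> Y)))"

definition lie_module :: "'v::ab_group_add svoa \<Rightarrow> 'v set \<Rightarrow> 'v set \<Rightarrow> bool" where
  "lie_module V W A \<longleftrightarrow> vsubspace V A \<and> (\<forall>u\<in>W. \<forall>a\<in>A. mode V u 0 a \<in> A) \<and>
     (\<forall>u\<in>W. \<forall>v\<in>W. \<forall>a\<in>A. mode V (mode V u 0 v) 0 a =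
        mode V u 0 (mode V v 0 a) - mode V v 0 (mode V u 0 a))"

text \<open>\<open>A\<close> is a two-dimensional irreducible module for \<open>W\<close>, acting by \<open>u \<mapsto> u(0)\<close>.\<close>

definition vector_rep :: "'v::ab_group_add svoa \<Rightarrow> 'v set \<Rightarrow> 'v set \<Rightarrow> bool" where
  "vector_rep V W A \<longleftrightarrow> lie_module V W A \<and> vdim V A = 2 \<and>
     (\<forall>A'. A' \<subseteq> A \<and> lie_module V W A' \<longrightarrow> A' = {0} \<or> A' = A)"


section \<open>The \<open>N = 4\<close> superconformal algebra\<close>

definition virasoro_element :: "'v::ab_group_add svoa \<Rightarrow> complex \<Rightarrow> 'v \<Rightarrow> bool" where
  "virasoro_element V c w \<longleftrightarrow>
     mode V w 0 w = mode V w (-2) (vac V) \<and> mode V w 1 w = smult V 2 w \<and> mode V w 2 w = 0 \<and>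
     mode V w 3 w = smult V (c / 2) (vac V) \<and> (\<forall>n\<ge>4. mode V w n w = 0)"

definition primary :: "'v::ab_group_add svoa \<Rightarrow> 'v \<Rightarrow> complex \<Rightarrow> 'v \<Rightarrow> bool" where
  "primary V w h u \<longleftrightarrow> mode V w 0 u = mode V u (-2) (vac V) \<and> mode V w 1 u = smult V h u \<and>
     (\<forall>n\<ge>2. mode V w n u = 0)"

text \<open>
  \<open>Gp, Gm, Hp, Hm\<close> stand for \<open>G\<^sup>+, G\<^sup>-\<close> and their overlined counterparts. Each conjunct lists
  \<open>u(n)v\<close> for all \<open>n \<ge> 0\<close>; products not listed come from these by super skew-symmetry.
\<close>

definition N4_relations :: "'v::ab_group_add svoa \<Rightarrow> complex \<Rightarrow>
    'v \<Rightarrow> 'v \<Rightarrow> 'v \<Rightarrow> 'v \<Rightarrow> 'v \<Rightarrow> 'v \<Rightarrow> 'v \<Rightarrow> 'v \<Rightarrow> bool" where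
  "N4_relations V c Gp Gm Hp Hm Jp Jm J0 w \<longleftrightarrow>
    (let m = mode V; s = smult V; one = vac V; T = (\<lambda>u. mode V u (-2) (vac V)) in
     virasoro_element V c w \<and>
     (\<forall>J\<in>{Jp, Jm, J0}. primary V w 1 J) \<and>
     (\<forall>G\<in>{Gp, Gm, Hp, Hm}. primary V w (3/2) G) \<and>
     m J0 0 Jp = s 2 Jp \<and> (\<forall>n\<ge>1. m J0 n Jp = 0) \<and>
     m J0 0 Jm = s (-2) Jm \<and> (\<forall>n\<ge>1. m J0 n Jm = 0) \<and>
     m J0 0 J0 = 0 \<and> m J0 1 J0 = s (c / 3) one \<and> (\<forall>n\<ge>2. m J0 n J0 = 0) \<and>
     m Jp 0 Jm = J0 \<and> m Jp 1 Jm = s (c / 6) one \<and> (\<forall>n\<ge>2. m Jp n Jm = 0) \<and>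
     (\<forall>n\<ge>0. m Jp n Jp = 0) \<and> (\<forall>n\<ge>0. m Jm n Jm = 0) \<and>
     m J0 0 Gp = Gp \<and> m J0 0 Gm = - Gm \<and> m J0 0 Hp = Hp \<and> m J0 0 Hm = - Hm \<and>
     m Jp 0 Gm = Gp \<and> m Jm 0 Gp = Gm \<and> m Jp 0 Hm = - Hp \<and> m Jm 0 Hp = - Hm \<and>
     m Jp 0 Gp = 0 \<and> m Jm 0 Gm = 0 \<and> m Jp 0 Hp = 0 \<and> m Jm 0 Hm = 0 \<and>
     (\<forall>J\<in>{Jp, Jm, J0}. \<forall>G\<in>{Gp, Gm, Hp, Hm}. \<forall>n\<ge>1. m J n G = 0) \<and>
     (\<forall>G\<in>{Gp, Gm}. \<forall>G'\<in>{Gp, Gm}. \<forall>n\<ge>0. m G n G' = 0) \<and>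
     (\<forall>H\<in>{Hp, Hm}. \<forall>H'\<in>{Hp, Hm}. \<forall>n\<ge>0. m H n H' = 0) \<and>
     m Gp 0 Hp = T Jp \<and> m Gp 1 Hp = s 2 Jp \<and> (\<forall>n\<ge>2. m Gp n Hp = 0) \<and>
     m Gm 0 Hm = T Jm \<and> m Gm 1 Hm = s 2 Jm \<and> (\<forall>n\<ge>2. m Gm n Hm = 0) \<and>
     m Gp 0 Hm = w + s (1/2) (T J0) \<and> m Gp 1 Hm = J0 \<and> m Gp 2 Hm = s (c / 3) one \<and>
       (\<forall>n\<ge>3. m Gp n Hm = 0) \<and>
     m Gm 0 Hp = w - s (1/2) (T J0) \<and> m Gm 1 Hp = - J0 \<and> m Gm 2 Hp = s (c / 3) one \<and>
       (\<forall>n\<ge>3. m Gm n Hp = 0))"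

text \<open>The subalgebra \<open>U\<close> of \<open>V\<close> is isomorphic to the \<open>N = 4\<close> algebra of central charge \<open>c\<close>.\<close>

definition is_N4 :: "'v::ab_group_add svoa \<Rightarrow> 'v set \<Rightarrow> complex \<Rightarrow> bool" where
  "is_N4 V U c \<longleftrightarrow> (\<exists>Gp Gm Hp Hm Jp Jm J0 w.
     {Gp, Gm, Hp, Hm} \<subseteq> wt V (3/2) \<and> U = generated V {Gp, Gm, Hp, Hm} \<and>
     {Jp, Jm, J0} \<subseteq> wt V 1 \<inter> U \<and> w \<in> wt V 2 \<inter> U \<and>
     N4_relations V c Gp Gm Hp Hm Jp Jm J0 w)"

end

theory Submission
  imports Defs
begin

text \<open>
  Let \<open>\<alpha>\<close> be the root of \<open>L\<close> in the Lie algebra \<open>W = A(1)B\<close>. The zero mode of \<open>J\<^sup>0 = \<alpha>(-1)\<one>\<close> acts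
  on \<open>V\<^sub>L\<close> diagonally, by the integer charge \<open>(\<alpha>, \<beta>)\<close> on every state \<open>e m \<beta>\<close>, and by the
  Cauchy-Schwarz inequality a state of weight \<open>k\<close> and charge \<open>t\<close> satisfies \<open>t\<^sup>2 \<le> 4 k\<close>. These
  two facts, the absence of states of weight \<open>1/2\<close> and \<open>J\<^sup>0(1)J\<^sup>0 = 2\<one>\<close> are all that the proof
  takes from the lattice.

  They first identify \<open>J\<^sup>0\<close> inside \<open>W\<close>. As \<open>J\<^sup>0(0)\<close> is semisimple, \<open>J\<^sup>0\<close> is not nilpotent in
  \<open>sl\<^sub>2\<close>, so it is \<open>\<mu>\<close> times the middle element of an \<open>sl\<^sub>2\<close>-triple. The charge \<open>2\<mu>\<close> of the
  raising element, which has weight one, is at most \<open>2\<close> in absolute value, while \<open>\<mu>\<close> itself is a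
  charge on the vector representation \<open>A\<close>, hence an integer. So \<open>\<mu> = \<plusminus>1\<close>, and \<open>J\<^sup>0\<close> is the middle
  element of a triple \<open>J\<^sup>+, J\<^sup>0, J\<^sup>-\<close> (\<open>sl2_triple_with_J0\<close>). Then \<open>J\<^sup>0(1)J\<^sup>0 = (c/3)\<one>\<close> gives \<open>c = 6\<close>: the
  currents form affine \<open>sl\<^sub>2\<close> at level one.

  The representations \<open>A\<close> and \<open>B\<close> become doublets \<open>G\<^sup>\<plusminus>\<close> and \<open>H\<^sup>\<plusminus>\<close> (where \<open>H\<close> stands for the
  overlined generators), and equivariance of \<open>A \<otimes> B \<rightarrow> W\<close> fixes the products \<open>G(1)H\<close> up to one
  nonzero scalar. The products \<open>G(2)H\<close> follow by applying \<open>J\<^sup>0(1)\<close>. The products at mode \<open>0\<close>,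
  which a priori are arbitrary states of weight two, are controlled by level one: a state of
  weight two and charge two killed by \<open>J\<^sup>-(1)\<close> is zero (\<open>charge_two_vanishes\<close>). This yields
  \<open>G\<^sup>+(0)G\<^sup>+ = 0\<close> and \<open>G\<^sup>+(0)H\<^sup>+ = T J\<^sup>+\<close>, and lowering by \<open>J\<^sup>-(0)\<close> yields the other ones.

  Finally \<open>\<omega> = G\<^sup>+(0)H\<^sup>- - (1/2) T J\<^sup>0\<close> is a Virasoro element, in general
  different from the conformal vector of \<open>V\<^sub>L\<close>. Since \<open>G\<^sup>+(m)\<close> and \<open>G\<^sup>+(n)\<close>
  anticommute, the products \<open>G\<^sup>+(n)\<omega>\<close> can be computed, and skew-symmetry turns them into the
  statement that \<open>G\<^sup>+\<close> is primary for \<open>\<omega>\<close>. The symmetry exchanging \<open>A\<close> and \<open>B\<close> fixes \<open>\<omega>\<close>, so all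
  four generators are primary, and the action of \<open>\<omega>\<close> on the currents and on itself is then forced
  because these are products of the generators.
\<close>

section \<open>Mode calculus in a super vertex operator algebra\<close>

context super_voa
begin

sublocale vs: vector_space "smult V"
  by (rule vector_space)

lemma mode_zero_left [simp]: "0\<langle>n\<rangle> v = 0"
  using mode_add_left[of 0 0 n v] by simp

lemma mode_zero_right [simp]: "u\<langle>n\<rangle> 0 = 0"
  using mode_add_right[of u n 0 0] by simp

lemma mode_minus_left [simp]: "(- u)\<langle>n\<rangle> v = - (u\<langle>n\<rangle> v)"
  using mode_add_left[of u "- u" n v] by (simp add: minus_unique)

lemma mode_minus_right [simp]: "u\<langle>n\<rangle> (- v) = - (u\<langle>n\<rangle> v)"
  using mode_add_right[of u n v "- v"] by (simp add: minus_unique)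

lemma mode_diff_left: "(u - u')\<langle>n\<rangle> v = u\<langle>n\<rangle> v - u'\<langle>n\<rangle> v"
  using mode_add_left[of u "- u'" n v] by simp

lemma mode_diff_right: "u\<langle>n\<rangle> (v - v') = u\<langle>n\<rangle> v - u\<langle>n\<rangle> v'"
  using mode_add_right[of u n v "- v'"] by simp

lemma mode_sum_left: "(\<Sum>i\<in>I. f i)\<langle>n\<rangle> v = (\<Sum>i\<in>I. (f i)\<langle>n\<rangle> v)"
  by (induction I rule: infinite_finite_induct) (simp_all add: mode_add_left)

lemma mode_sum_right: "u\<langle>n\<rangle> (\<Sum>i\<in>I. f i) = (\<Sum>i\<in>I. u\<langle>n\<rangle> (f i))"
  by (induction I rule: infinite_finite_induct) (simp_all add: mode_add_right)

lemmas mode_bilinear = mode_add_left mode_add_right mode_diff_left mode_diff_right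
  mode_scale_left mode_scale_right

lemma wt_add: "u \<in> wt V k \<Longrightarrow> v \<in> wt V k \<Longrightarrow> u + v \<in> wt V k"
  using wt_subspace vs.subspace_add by blast
lemma wt_diff: "u \<in> wt V k \<Longrightarrow> v \<in> wt V k \<Longrightarrow> u - v \<in> wt V k"
  using wt_subspace vs.subspace_diff by blast
lemma wt_neg: "u \<in> wt V k \<Longrightarrow> - u \<in> wt V k"
  using wt_subspace vs.subspace_neg by blast
lemma wt_scale: "u \<in> wt V k \<Longrightarrow> smult V a u \<in> wt V k"
  using wt_subspace vs.subspace_scale by blast

lemma power_int_minus_one: "(- 1 :: complex) powi i = (if even i then 1 else - 1)" for i :: int
  by (simp add: power_int_minus_left)

text \<open>The Borcherds identity at \<open>l = 0\<close>.\<close>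
lemma commutator:
  assumes u: "u \<in> wt V (of_int p / 2)" and v: "v \<in> wt V (of_int q / 2)"
    and N: "\<And>j. j \<ge> N \<Longrightarrow> u\<langle>int j\<rangle> v = 0"
  shows "u\<langle>m\<rangle> (v\<langle>n\<rangle> w) = smult V (if even (p * q) then 1 else - 1) (v\<langle>n\<rangle> (u\<langle>m\<rangle> w))
    + (\<Sum>j<N. smult V (of_int m gchoose j) ((u\<langle>int j\<rangle> v)\<langle>m + n - int j\<rangle> w))"
proof -
  let ?l = "\<lambda>j. smult V (of_int m gchoose j) ((u\<langle>0 + int j\<rangle> v)\<langle>m + n - int j\<rangle> w)"
  let ?r = "\<lambda>j. smult V ((-1) ^ j * (of_int 0 gchoose j))
        (u\<langle>m + 0 - int j\<rangle> (v\<langle>n + int j\<rangle> w)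
          - smult V ((-1) powi (0 + p * q)) (v\<langle>n + 0 - int j\<rangle> (u\<langle>m + int j\<rangle> w)))"
  have "Sum_any ?l = sum ?l {..<N}"
    by (rule Sum_any.expand_superset) (use N in \<open>auto simp flip: not_le\<close>)
  moreover have "Sum_any ?r = sum ?r {0}"
    by (rule Sum_any.expand_superset) (auto simp: gbinomial_0_left split: if_splits)
  moreover have "Sum_any ?l = Sum_any ?r"
    by (rule borcherds[OF u v])
  ultimately show ?thesis
    by (simp add: algebra_simps power_int_minus_one)
qed

lemma even_commutator:
  assumes u: "u \<in> wt V (of_int p)" and v: "v \<in> wt V (of_int q / 2)"
    and N: "\<And>j. j \<ge> N \<Longrightarrow> u\<langle>int j\<rangle> v = 0"
  shows "u\<langle>m\<rangle> (v\<langle>n\<rangle> w) = v\<langle>n\<rangle> (u\<langle>m\<rangle> w)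
    + (\<Sum>j<N. smult V (of_int m gchoose j) ((u\<langle>int j\<rangle> v)\<langle>m + n - int j\<rangle> w))"
proof -
  have "u \<in> wt V (of_int (2 * p) / 2)" using u by simp
  from commutator[OF this v N] show ?thesis by (simp add: power_int_minus_one)
qed

lemma zero_mode_commutator:
  assumes u: "u \<in> wt V (of_int p)" and v: "v \<in> wt V (of_int q / 2)"
  shows "u\<langle>0\<rangle> (v\<langle>n\<rangle> w) = v\<langle>n\<rangle> (u\<langle>0\<rangle> w) + (u\<langle>0\<rangle> v)\<langle>n\<rangle> w"
proof -
  obtain N0 where N0: "\<forall>n\<ge>N0. u\<langle>n\<rangle> v = 0" using truncation by blast
  define N where "N = Suc (nat N0)"
  have "u\<langle>int j\<rangle> v = 0" if "j \<ge> N" for j using N0 that by (auto simp: N_def)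
  from even_commutator[OF u v this, where m = 0 and n = n and w = w]
  have "u\<langle>0\<rangle> (v\<langle>n\<rangle> w) = v\<langle>n\<rangle> (u\<langle>0\<rangle> w)
     + (\<Sum>j<N. smult V (0 gchoose j) ((u\<langle>int j\<rangle> v)\<langle>n - int j\<rangle> w))" by simp
  also have "(\<Sum>j<N. smult V (0 gchoose j) ((u\<langle>int j\<rangle> v)\<langle>n - int j\<rangle> w))
      = (\<Sum>j\<in>{0}. smult V (0 gchoose j) ((u\<langle>int j\<rangle> v)\<langle>n - int j\<rangle> w))"
    by (rule sum.mono_neutral_right) (auto simp: N_def gbinomial_0_left)
  finally show ?thesis by simp
qed

text \<open>The translation operator: \<open>T = L(-1)\<close>.\<close>
abbreviation T :: "'v \<Rightarrow> 'v" where "T u \<equiv> u\<langle>-2\<rangle> \<one>"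

text \<open>
  The Borcherds identity with \<open>v = \<one>\<close>, \<open>l = -2\<close> and \<open>m = 0\<close>: of the two families of terms on its right
  side, one contributes only for \<open>n < 0\<close> and the other only for \<open>n > 0\<close>.
\<close>
lemma T_mode:
  assumes u: "u \<in> wt V (of_int p / 2)"
  shows "(T u)\<langle>n\<rangle> w = smult V (- of_int n) (u\<langle>n - 1\<rangle> w)"
proof -
  let ?l = "\<lambda>j. smult V (of_int 0 gchoose j) ((u\<langle>-2 + int j\<rangle> \<one>)\<langle>0 + n - int j\<rangle> w)"
  let ?r = "\<lambda>j. smult V ((-1) ^ j * (of_int (-2) gchoose j))
        (u\<langle>0 + -2 - int j\<rangle> (\<one>\<langle>n + int j\<rangle> w)
          - smult V ((-1) powi (-2 + p * 0)) (\<one>\<langle>n + -2 - int j\<rangle> (u\<langle>0 + int j\<rangle> w)))"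
  have choose: "(-1) ^ j * (- 2 gchoose j :: complex) = of_nat (Suc j)" for j
    using binomial_gbinomial[of "Suc j" j, where 'a = complex]
    by (simp add: gbinomial_minus add.commute)
  have l: "Sum_any ?l = sum ?l {0}"
    by (rule Sum_any.expand_superset) (auto simp: gbinomial_0_left split: if_splits)
  have lr: "Sum_any ?l = Sum_any ?r"
    by (rule borcherds[OF u]) (simp add: vac_wt)
  have left_term: "u\<langle>0 + -2 - int j\<rangle> (\<one>\<langle>n + int j\<rangle> w) = (if n + int j = -1 then u\<langle>n - 1\<rangle> w else 0)"
    for j by (auto simp: vacuum algebra_simps intro: arg_cong)
  have right_term: "\<one>\<langle>n + -2 - int j\<rangle> (u\<langle>0 + int j\<rangle> w) = (if n - int j = 1 then u\<langle>n - 1\<rangle> w else 0)"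
    for j by (auto simp: vacuum algebra_simps)
  have "(T u)\<langle>n\<rangle> w = Sum_any ?r"
    using lr l by simp
  also have "\<dots> = Sum_any (\<lambda>j. smult V (of_nat (Suc j))
      ((if n + int j = -1 then u\<langle>n - 1\<rangle> w else 0) - (if n - int j = 1 then u\<langle>n - 1\<rangle> w else 0)))"
    unfolding left_term right_term using choose by simp
  also have "\<dots> = sum (\<lambda>j. smult V (of_nat (Suc j))
      ((if n + int j = -1 then u\<langle>n - 1\<rangle> w else 0) - (if n - int j = 1 then u\<langle>n - 1\<rangle> w else 0)))
      {if n < 0 then nat (- 1 - n) else nat (n - 1)}"
    by (rule Sum_any.expand_superset) (auto split: if_splits)
  also have "\<dots> = smult V (- of_int n) (u\<langle>n - 1\<rangle> w)"
    by (cases "n < 0"; cases "n = 0") (auto simp: of_nat_nat)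
  finally show ?thesis .
qed

lemma T_derivation:
  assumes u: "u \<in> wt V (of_int p / 2)"
  shows "T (u\<langle>n\<rangle> v) = (T u)\<langle>n\<rangle> v + u\<langle>n\<rangle> (T v)"
  using zero_mode_commutator[of "\<omega>" 2 u p n v] u conf_wt by (simp add: Lminus1)

text \<open>Eigenvectors of \<open>L(0)\<close> with distinct eigenvalues are independent.\<close>
lemma weight_sum_eq_0:
  assumes "finite K" "\<And>k. k \<in> K \<Longrightarrow> f k \<in> wt V k" "(\<Sum>k\<in>K. f k) = 0"
  shows "\<forall>k\<in>K. f k = 0"
  using assms
proof (induction K arbitrary: f rule: finite_induct)
  case (insert k0 K)
  have "\<omega>\<langle>1\<rangle> (\<Sum>k\<in>insert k0 K. f k) = (\<Sum>k\<in>insert k0 K. smult V (of_real k) (f k))"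
    unfolding mode_sum_right using insert.prems(1) by (intro sum.cong) (auto simp: L0)
  then have "(\<Sum>k\<in>insert k0 K. smult V (of_real k) (f k)) = 0"
    by (simp only: insert.prems(2) mode_zero_right)
  then have "(\<Sum>k\<in>insert k0 K. smult V (of_real k) (f k)) - smult V (of_real k0) (\<Sum>k\<in>insert k0 K. f k) = 0"
    by (simp only: insert.prems(2)) simp
  then have "(\<Sum>k\<in>K. smult V (of_real (k - k0)) (f k)) = 0"
    using insert.hyps
    by (simp add: vs.scale_right_distrib vs.scale_sum_right vs.scale_left_diff_distrib sum_subtractf)
  then have "\<forall>k\<in>K. smult V (of_real (k - k0)) (f k) = 0"
    by (intro insert.IH) (use insert.prems in \<open>auto intro: wt_scale\<close>)
  then have "\<forall>k\<in>K. f k = 0"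
    using insert.hyps by auto
  with insert.prems(2) insert.hyps show ?case by simp
qed simp

lemma weight_decomposition:
  obtains K f where "finite K" "\<And>k. f k \<in> wt V k" "v = (\<Sum>k\<in>K. f k)"
proof -
  have "v \<in> vspan V (\<Union>k. wt V k)" using wt_span by simp
  then have "\<exists>K f. finite K \<and> (\<forall>k. f k \<in> wt V k) \<and> v = (\<Sum>k\<in>K. f k)"
  proof (induction rule: vs.span_induct_alt)
    case base
    show ?case
      by (rule exI[of _ "{}"], rule exI[of _ "\<lambda>_. 0"])
        (use wt_subspace vs.subspace_0 in auto)
  next
    case (step c x y)
    then obtain k K f where *: "x \<in> wt V k" "finite K" "\<forall>k. f k \<in> wt V k" "y = (\<Sum>k\<in>K. f k)"
      by blast
    define g where "g = (if k \<in> K then f else f(k := 0))"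
    have g: "g j \<in> wt V j" for j
      using * wt_subspace vs.subspace_0 by (auto simp: g_def)
    have "y = (\<Sum>k\<in>insert k K. g k)"
      using *(2,4) by (auto simp: g_def insert_absorb intro!: sum.cong)
    then have "smult V c x + y = (\<Sum>j\<in>insert k K. (g(k := g k + smult V c x)) j)"
      using *(2) by (simp add: sum.insert_remove algebra_simps)
    moreover have "(g(k := g k + smult V c x)) j \<in> wt V j" for j
      using g * by (auto intro: wt_add wt_scale)
    ultimately show ?case using *(2) by blast
  qed
  then show ?thesis using that by blast
qed

lemma weight_eigenspace:
  assumes "\<omega>\<langle>1\<rangle> v = smult V (of_real r) v"
  shows "v \<in> wt V r"
proof -
  obtain K f where K: "finite K" and f: "\<And>k. f k \<in> wt V k" and v: "v = (\<Sum>k\<in>K. f k)"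
    using weight_decomposition by metis
  have "(\<Sum>k\<in>K. smult V (of_real (k - r)) (f k)) = \<omega>\<langle>1\<rangle> v - smult V (of_real r) v"
    unfolding v mode_sum_right
    by (simp add: vs.scale_sum_right vs.scale_left_diff_distrib sum_subtractf L0[OF f])
  then have "(\<Sum>k\<in>K. smult V (of_real (k - r)) (f k)) = 0" using assms by simp
  then have "\<forall>k\<in>K. smult V (of_real (k - r)) (f k) = 0"
    by (intro weight_sum_eq_0 K wt_scale f)
  then have "\<forall>k\<in>K. k \<noteq> r \<longrightarrow> f k = 0" by auto
  then have "f k \<in> wt V r" if "k \<in> K" for k
    using f[of k] that wt_subspace vs.subspace_0 by (cases "k = r") auto
  then show ?thesis
    unfolding v by (intro vs.subspace_sum wt_subspace)
qed

text \<open>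
  The commutator \<open>[L(0), u(n)] = (wt u - n - 1) u(n)\<close> determines the \<open>L(0)\<close>-eigenvalue of \<open>u(n)v\<close>, and
  an eigenvalue determines the weight space. This gives the weights of products of two states of
  half-integral weight.
\<close>
lemma mode_weight:
  assumes u: "u \<in> wt V (of_int p / 2)" and v: "v \<in> wt V l"
  shows "u\<langle>n\<rangle> v \<in> wt V (of_int p / 2 + l - of_int n - 1)"
proof (rule weight_eigenspace)
  obtain N0 where N0: "\<forall>n\<ge>N0. \<omega>\<langle>n\<rangle> u = 0" using truncation by blast
  define N where "N = nat N0 + 2"
  have N: "\<omega>\<langle>int j\<rangle> u = 0" if "j \<ge> N" for j using N0 that by (auto simp: N_def)
  have "\<omega> \<in> wt V (of_int 2)" using conf_wt by simp
  from even_commutator[OF this u N, where m = 1 and n = n and w = v]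
  have "\<omega>\<langle>1\<rangle> (u\<langle>n\<rangle> v) = u\<langle>n\<rangle> (\<omega>\<langle>1\<rangle> v)
     + (\<Sum>j<N. smult V (1 gchoose j) ((\<omega>\<langle>int j\<rangle> u)\<langle>1 + n - int j\<rangle> v))" by simp
  also have "(\<Sum>j<N. smult V (1 gchoose j) ((\<omega>\<langle>int j\<rangle> u)\<langle>1 + n - int j\<rangle> v))
     = (\<Sum>j\<in>{0,1}. smult V (1 gchoose j) ((\<omega>\<langle>int j\<rangle> u)\<langle>1 + n - int j\<rangle> v))"
  proof (rule sum.mono_neutral_right)
    have "(1 gchoose j) = (0::complex)" if "j \<notin> {0, 1}" for j
      using binomial_gbinomial[of 1 j, where 'a = complex] that by (simp add: binomial_eq_0)
    then show "\<forall>j\<in>{..<N} - {0, 1}. smult V (1 gchoose j) ((\<omega>\<langle>int j\<rangle> u)\<langle>1 + n - int j\<rangle> v) = 0"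
      by auto
  qed (auto simp: N_def)
  also have "\<dots> = smult V (of_real (of_int p / 2 - of_int n - 1)) (u\<langle>n\<rangle> v)"
    using T_mode[OF u, of "1 + n" v]
    by (simp add: Lminus1 L0[OF u] mode_scale_left flip: vs.scale_left_distrib)
  finally show "\<omega>\<langle>1\<rangle> (u\<langle>n\<rangle> v) = smult V (of_real (of_int p / 2 + l - of_int n - 1)) (u\<langle>n\<rangle> v)"
    by (simp add: L0[OF v] mode_scale_right algebra_simps flip: vs.scale_left_distrib)
qed

text \<open>
  The Borcherds identity with \<open>w = \<one>\<close>, \<open>m = -1\<close> and \<open>n = 0\<close>. The states \<open>x(-1-j)\<one>\<close> are the
  divided powers \<open>T\<^sup>j x / j!\<close>.
\<close>
lemma skew_symmetry:
  assumes u: "u \<in> wt V (of_int p / 2)" and v: "v \<in> wt V (of_int q / 2)"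
    and N: "\<And>j. j \<ge> N \<Longrightarrow> u\<langle>l + int j\<rangle> v = 0"
  shows "v\<langle>l\<rangle> u = smult V (if even (l + p * q) then - 1 else 1)
    (\<Sum>j<N. smult V ((-1) ^ j) ((u\<langle>l + int j\<rangle> v)\<langle>- 1 - int j\<rangle> \<one>))"
proof -
  let ?l = "\<lambda>j. smult V (of_int (-1) gchoose j) ((u\<langle>l + int j\<rangle> v)\<langle>-1 + 0 - int j\<rangle> \<one>)"
  let ?r = "\<lambda>j. smult V ((-1) ^ j * (of_int l gchoose j))
        (u\<langle>-1 + l - int j\<rangle> (v\<langle>0 + int j\<rangle> \<one>)
          - smult V ((-1) powi (l + p * q)) (v\<langle>0 + l - int j\<rangle> (u\<langle>-1 + int j\<rangle> \<one>)))"
  have choose: "(- 1 gchoose j :: complex) = (-1) ^ j" for j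
    using binomial_gbinomial[of j j, where 'a = complex] by (simp add: gbinomial_minus)
  have creation_at: "u\<langle>int j - 1\<rangle> \<one> = 0" if "j \<noteq> 0" for j
    using that by (intro creation) auto
  have "Sum_any ?l = sum ?l {..<N}"
    by (rule Sum_any.expand_superset) (use N in \<open>auto simp flip: not_le\<close>)
  moreover have "Sum_any ?r = sum ?r {0}"
    by (rule Sum_any.expand_superset) (auto simp: creation, metis creation_at mode_zero_right)
  moreover have "Sum_any ?l = Sum_any ?r"
    by (rule borcherds[OF u v])
  ultimately have "(\<Sum>j<N. smult V ((-1) ^ j) ((u\<langle>l + int j\<rangle> v)\<langle>- 1 - int j\<rangle> \<one>))
      = - smult V ((-1) powi (l + p * q)) (v\<langle>l\<rangle> u)"
    by (simp add: choose creation)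
  then show ?thesis
    by (cases "even l"; cases "even p"; cases "even q") (simp_all add: power_int_minus_one)
qed

lemma double_eq_0: "x + x = 0 \<Longrightarrow> x = 0" for x :: 'v
proof -
  assume "x + x = 0"
  then have "smult V 2 x = 0"
    using vs.scale_left_distrib[of 1 1 x] by simp
  then show "x = 0" by simp
qed

lemma vacuum_T [simp]: "T \<one> = 0"
  by (simp add: vacuum)

lemma mode_T:
  assumes "u \<in> wt V (of_int p / 2)"
  shows "u\<langle>n\<rangle> (T v) = T (u\<langle>n\<rangle> v) + smult V (of_int n) (u\<langle>n - 1\<rangle> v)"
  using T_derivation[OF assms, of n v] T_mode[OF assms, of n v] by simp

lemma zero_mode_T:
  assumes "u \<in> wt V (of_int p / 2)"
  shows "u\<langle>0\<rangle> (T v) = T (u\<langle>0\<rangle> v)"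
  using mode_T[OF assms, of 0 v] by simp

text \<open>
  This determines the action of \<open>w\<close> on products of primary states; it is how the conformal
  properties of the generators pass to the currents and to the Virasoro element itself.
\<close>
lemma primary_commutator:
  assumes w: "w \<in> wt V 2" and u: "u \<in> wt V (of_int q / 2)" and "primary V w h u"
  shows "w\<langle>m\<rangle> (u\<langle>n\<rangle> v) = u\<langle>n\<rangle> (w\<langle>m\<rangle> v)
    + smult V (of_int m * h - of_int (m + n)) (u\<langle>m + n - 1\<rangle> v)"
proof -
  have w': "w \<in> wt V (of_int 2)" using w by simp
  have p: "w\<langle>0\<rangle> u = T u" "w\<langle>1\<rangle> u = smult V h u" "\<And>j. j \<ge> 2 \<Longrightarrow> w\<langle>int j\<rangle> u = 0"
    using assms(3) by (auto simp: primary_def)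
  show ?thesis
    using even_commutator[OF w' u p(3), where N = 2 and m = m and n = n and w = v]
      p(1,2) T_mode[OF u, of "m + n" v]
    by (simp add: numeral_2_eq_2 mode_scale_left algebra_simps vs.scale_left_diff_distrib
        vs.scale_left_distrib)
qed

lemma primary_scale:
  assumes "primary V w h u" shows "primary V w h (smult V a u)"
  using assms by (simp add: primary_def mode_bilinear vs.scale_left_commute)

lemma generated_mono:
  assumes "S \<subseteq> vspan V S'"
  shows "generated V S \<subseteq> generated V S'"
proof -
  have "x \<in> vspan V (mode_words V S')" if "x \<in> mode_words V S" for x
    using that
  proof induction
    case vac_word
    then show ?case by (simp add: mode_words.vac_word vs.span_base)
  next
    case (step_word u x n)
    have word: "u\<langle>n\<rangle> x \<in> vspan V (mode_words V S')" if "u \<in> S'" for u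
      using step_word.IH
    proof (induction rule: vs.span_induct_alt)
      case (step a v w)
      then show ?case
        using that by (simp add: mode_bilinear mode_words.step_word vs.span_add vs.span_scale vs.span_base)
    qed (simp add: vs.span_zero)
    have "u \<in> vspan V S'" using step_word.hyps(1) assms by blast
    then show ?case
    proof (induction rule: vs.span_induct_alt)
      case (step a v w)
      then show ?case
        using word[OF step(1)] by (simp add: mode_bilinear vs.span_add vs.span_scale)
    qed (simp add: vs.span_zero)
  qed
  then show ?thesis
    unfolding generated_def by (intro vs.span_minimal) auto
qed

lemma generated_subspace: "vsubspace V (generated V S)"
  by (simp add: generated_def)

lemma mode_in_generated: "u \<in> S \<Longrightarrow> v \<in> S \<Longrightarrow> u\<langle>n\<rangle> v \<in> generated V S"
  using mode_words.step_word[OF _ mode_words.step_word[OF _ mode_words.vac_word, of v S V "-1"], of u n]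
  by (simp add: creation generated_def vs.span_base)

end

section \<open>Two doublets over affine \<open>sl\<^sub>2\<close> at level one\<close>

text \<open>
  The normalised situation: the currents \<open>J\<^sup>\<plusminus>, J\<^sup>0\<close> and the two doublets \<open>G\<^sup>\<plusminus>, H\<^sup>\<plusminus>\<close> they act on.
  Of the lattice only the bound \<open>t\<^sup>2 \<le> 4 k\<close> between charge \<open>t\<close> and weight \<open>k\<close> and the missing
  weights are remembered. The level is one because of \<open>J\<^sup>0(1)J\<^sup>0 = 2\<one>\<close>. The minus signs in the
  action on \<open>H\<^sup>\<plusminus>\<close> are those of the \<open>N = 4\<close> relations; it is \<open>(H\<^sup>+, - H\<^sup>-)\<close> that transforms like
  \<open>(G\<^sup>+, G\<^sup>-)\<close>.
\<close>
locale sl2_doublets = super_voa V c for V :: "'v::ab_group_add svoa" (structure) and c +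
  fixes Gp Gm Hp Hm Jp Jm J0 :: 'v
  assumes wt_negative: "k < 0 \<Longrightarrow> wt V k = {0}"
    and wt_half: "wt V (1/2) = {0}"
    and charge_bound: "v \<in> wt V k \<Longrightarrow> J0\<langle>0\<rangle> v = smult V (of_real t) v \<Longrightarrow> 4 * k < t\<^sup>2 \<Longrightarrow> v = 0"
    and wt_J: "Jp \<in> wt V 1" "Jm \<in> wt V 1" "J0 \<in> wt V 1"
    and wt_G: "Gp \<in> wt V (3/2)" "Gm \<in> wt V (3/2)"
    and wt_H: "Hp \<in> wt V (3/2)" "Hm \<in> wt V (3/2)"
    and J_J: "J0\<langle>0\<rangle> Jp = smult V 2 Jp" "J0\<langle>0\<rangle> Jm = smult V (-2) Jm" "Jp\<langle>0\<rangle> Jm = J0"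
      "J0\<langle>0\<rangle> J0 = 0" "J0\<langle>1\<rangle> J0 = smult V 2 \<one>"
    and J_G: "J0\<langle>0\<rangle> Gp = Gp" "J0\<langle>0\<rangle> Gm = - Gm"
      "Jp\<langle>0\<rangle> Gp = 0" "Jp\<langle>0\<rangle> Gm = Gp" "Jm\<langle>0\<rangle> Gp = Gm" "Jm\<langle>0\<rangle> Gm = 0"
    and J_H: "J0\<langle>0\<rangle> Hp = Hp" "J0\<langle>0\<rangle> Hm = - Hm"
      "Jp\<langle>0\<rangle> Hp = 0" "Jp\<langle>0\<rangle> Hm = - Hp" "Jm\<langle>0\<rangle> Hp = - Hm" "Jm\<langle>0\<rangle> Hm = 0"
    and G_G: "X \<in> {Gp, Gm} \<Longrightarrow> Y \<in> {Gp, Gm} \<Longrightarrow> X\<langle>1\<rangle> Y = 0"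
    and H_H: "X \<in> {Hp, Hm} \<Longrightarrow> Y \<in> {Hp, Hm} \<Longrightarrow> X\<langle>1\<rangle> Y = 0"
    and Gp_Hp: "Gp\<langle>1\<rangle> Hp = smult V 2 Jp" and Gp_Hm: "Gp\<langle>1\<rangle> Hm = J0"
begin

lemma mode_negative_weight:
  assumes "u \<in> wt V (of_int p / 2)" "v \<in> wt V k" "of_int p / 2 + k < of_int n + 1"
  shows "u\<langle>n\<rangle> v = 0"
  using mode_weight[OF assms(1,2), of n] wt_negative assms(3) by (auto simp: algebra_simps)

lemma wt_1_D: "u \<in> wt V 1 \<Longrightarrow> u \<in> wt V (of_int 2 / 2)" "u \<in> wt V 1 \<Longrightarrow> u \<in> wt V (of_int 1)"
  by simp_all

lemma wt_32_D: "u \<in> wt V (3/2) \<Longrightarrow> u \<in> wt V (of_int 3 / 2)"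
  by simp

lemma wt_2_D: "u \<in> wt V 2 \<Longrightarrow> u \<in> wt V (of_int 4 / 2)"
  by simp

text \<open>There are no states of weight \<open>1/2\<close>, so only the zero mode of a current acts on a doublet.\<close>
lemma current_doublet:
  assumes J: "J \<in> wt V 1" and X: "X \<in> wt V (3/2)" and n: "n \<ge> 1"
  shows "J\<langle>n\<rangle> X = 0" "X\<langle>n\<rangle> J = 0" "X\<langle>0\<rangle> J = - (J\<langle>0\<rangle> X)"
proof -
  have z: "J\<langle>n\<rangle> X = 0" if "n \<ge> 1" for n
  proof (cases "n = 1")
    case True
    then show ?thesis using mode_weight[OF wt_1_D(1)[OF J] X, of 1] wt_half by simp
  next
    case False
    with that show ?thesis by (intro mode_negative_weight[OF wt_1_D(1)[OF J] X]) auto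
  qed
  show "J\<langle>n\<rangle> X = 0" using z n .
  show "X\<langle>n\<rangle> J = 0"
    using skew_symmetry[OF wt_1_D(1)[OF J] wt_32_D[OF X], of 0 n] z n by simp
  show "X\<langle>0\<rangle> J = - (J\<langle>0\<rangle> X)"
    using skew_symmetry[OF wt_1_D(1)[OF J] wt_32_D[OF X], of 1 0] z by (simp add: creation)
qed

lemma current_doublet_commutator:
  assumes J: "J \<in> wt V 1" and X: "X \<in> wt V (3/2)"
  shows "J\<langle>m\<rangle> (X\<langle>n\<rangle> w) = X\<langle>n\<rangle> (J\<langle>m\<rangle> w) + (J\<langle>0\<rangle> X)\<langle>m + n\<rangle> w"
  using even_commutator[OF wt_1_D(2)[OF J] wt_32_D[OF X], where N = 1 and m = m and n = n and w = w] current_doublet(1)[OF J X]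
  by simp

lemma current_current_commutator:
  assumes J: "J \<in> wt V 1" and J': "J' \<in> wt V 1" and k: "J\<langle>1\<rangle> J' = smult V k \<one>"
  shows "J\<langle>m\<rangle> (J'\<langle>n\<rangle> w) = J'\<langle>n\<rangle> (J\<langle>m\<rangle> w) + (J\<langle>0\<rangle> J')\<langle>m + n\<rangle> w
    + (if m + n = 0 then smult V (of_int m * k) w else 0)"
proof -
  have "J\<langle>int j\<rangle> J' = 0" if "j \<ge> 2" for j
    using that by (intro mode_negative_weight[OF wt_1_D(1)[OF J] J']) auto
  from even_commutator[OF wt_1_D(2)[OF J] wt_1_D(1)[OF J'] this, where m = m and n = n and w = w]
  show ?thesis using k by (simp add: numeral_2_eq_2 vacuum mode_scale_left)
qed

text \<open>These states have weight zero but nonzero charge.\<close>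
lemma J0_Jpm: "J0\<langle>1\<rangle> Jp = 0" "J0\<langle>1\<rangle> Jm = 0"
proof -
  have J0: "J0\<langle>0\<rangle> (J0\<langle>1\<rangle> J) = J0\<langle>1\<rangle> (J0\<langle>0\<rangle> J)" for J
    using zero_mode_commutator[OF wt_1_D(2)[OF wt_J(3)] wt_1_D(1)[OF wt_J(3)], of 1 J] J_J(4) by simp
  have w: "J0\<langle>1\<rangle> J \<in> wt V 0" if "J \<in> wt V 1" for J
    using mode_weight[OF wt_1_D(1)[OF wt_J(3)] that, of 1] by simp
  show "J0\<langle>1\<rangle> Jp = 0"
    by (rule charge_bound[where t = 2, OF w]) (simp_all add: wt_J J0 J_J mode_scale_right)
  show "J0\<langle>1\<rangle> Jm = 0"
    by (rule charge_bound[where t = "-2", OF w]) (simp_all add: wt_J J0 J_J mode_scale_right)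
qed

text \<open>
  Invariance of the form \<open>u(1)v\<close> on the currents: \<open>J\<^sup>0(1)J\<^sup>0\<close> and \<open>2 J\<^sup>+(1)J\<^sup>-\<close> are both
  \<open>J\<^sup>0(1)J\<^sup>+(0)J\<^sup>-\<close>.
\<close>
lemma Jp_Jm: "Jp\<langle>1\<rangle> Jm = \<one>"
proof -
  have "J0\<langle>1\<rangle> (Jp\<langle>0\<rangle> Jm) = smult V 2 (Jp\<langle>1\<rangle> Jm)"
    using current_current_commutator[OF wt_J(3,1), of 0 1 0 Jm] J0_Jpm J_J(1) by (simp add: mode_scale_left)
  then have "smult V 2 (Jp\<langle>1\<rangle> Jm) = smult V 2 \<one>" using J_J(3,5) by simp
  then show ?thesis by simp
qed

lemma current_current_high:
  assumes "J \<in> wt V 1" "J' \<in> wt V 1" "n \<ge> 2"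
  shows "J\<langle>n\<rangle> J' = 0"
  using assms(3) by (intro mode_negative_weight[OF wt_1_D(1)[OF assms(1)] assms(2)]) auto

lemma Jp_Jp: "n \<ge> 0 \<Longrightarrow> Jp\<langle>n\<rangle> Jp = 0"
proof (rule charge_bound[where t = 4])
  show "Jp\<langle>n\<rangle> Jp \<in> wt V (1 - of_int n)"
    using mode_weight[OF wt_1_D(1)[OF wt_J(1)] wt_J(1), of n] by simp
  show "J0\<langle>0\<rangle> (Jp\<langle>n\<rangle> Jp) = smult V (complex_of_real 4) (Jp\<langle>n\<rangle> Jp)"
    using current_current_commutator[OF wt_J(3,1), of 0 0 n Jp] J0_Jpm J_J(1)
    by (simp add: mode_scale_left mode_scale_right flip: vs.scale_left_distrib)
qed simp

lemma Jm_Jm: "n \<ge> 0 \<Longrightarrow> Jm\<langle>n\<rangle> Jm = 0"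
proof (rule charge_bound[where t = "-4"])
  show "Jm\<langle>n\<rangle> Jm \<in> wt V (1 - of_int n)"
    using mode_weight[OF wt_1_D(1)[OF wt_J(2)] wt_J(2), of n] by simp
  show "J0\<langle>0\<rangle> (Jm\<langle>n\<rangle> Jm) = smult V (complex_of_real (-4)) (Jm\<langle>n\<rangle> Jm)"
    using current_current_commutator[OF wt_J(3,2), of 0 0 n Jm] J0_Jpm J_J(2)
      vs.scale_left_distrib[of 2 2 "Jm\<langle>n\<rangle> Jm"]
    by (simp add: mode_scale_left mode_scale_right)
qed simp

lemma Jm_Jp: "Jm\<langle>0\<rangle> Jp = - J0" "Jm\<langle>1\<rangle> Jp = \<one>" and Jm_J0: "Jm\<langle>0\<rangle> J0 = smult V 2 Jm"
proof -
  note skew = skew_symmetry[OF wt_1_D(1) wt_1_D(1)]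
  show "Jm\<langle>0\<rangle> Jp = - J0"
    using skew[OF wt_J(1,2), of 2 0] current_current_high[OF wt_J(1,2)] J_J(3) Jp_Jm
    by (simp add: numeral_2_eq_2 creation)
  show "Jm\<langle>1\<rangle> Jp = \<one>"
    using skew[OF wt_J(1,2), of 1 1] current_current_high[OF wt_J(1,2)] Jp_Jm
    by (simp add: creation)
  have "J0\<langle>int j\<rangle> Jm = 0" if "j \<ge> 1" for j
    using that J0_Jpm(2) current_current_high[OF wt_J(3,2), of "int j"] by (cases "j = 1") auto
  then show "Jm\<langle>0\<rangle> J0 = smult V 2 Jm"
    using skew[OF wt_J(3,2), of 1 0] J_J(2) by (simp add: creation)
qed

text \<open>
  The operators \<open>J\<^sup>-(1), J\<^sup>+(-1)\<close> and \<open>1 - J\<^sup>0(0)\<close> form an \<open>sl\<^sub>2\<close>-triple, for which \<open>X\<close> would be a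
  highest weight vector of weight \<open>1 - 2 = -1\<close>. The charge bound kills \<open>J\<^sup>+(-1)X\<close>, of weight \<open>3\<close> and
  charge \<open>4\<close>, so a nonzero \<open>X\<close> would span a one-dimensional representation of nonzero weight. This
  is the vanishing theorem for level-one integrable representations in the only case that occurs.
\<close>
lemma charge_two_vanishes:
  assumes X: "X \<in> wt V 2" and charge: "J0\<langle>0\<rangle> X = smult V 2 X" and hw: "Jm\<langle>1\<rangle> X = 0"
  shows "X = 0"
proof -
  have "Jp\<langle>-1\<rangle> X = 0"
  proof (rule charge_bound[where k = 3 and t = 4])
    show "Jp\<langle>-1\<rangle> X \<in> wt V 3"
      using mode_weight[OF wt_1_D(1)[OF wt_J(1)] X, of "-1"] by simp
    show "J0\<langle>0\<rangle> (Jp\<langle>-1\<rangle> X) = smult V (complex_of_real 4) (Jp\<langle>-1\<rangle> X)"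
      using current_current_commutator[OF wt_J(3,1), of 0 0 "-1" X] J0_Jpm J_J(1) charge
      by (simp add: mode_scale_left mode_scale_right flip: vs.scale_left_distrib)
  qed simp
  then have "Jm\<langle>1\<rangle> (Jp\<langle>-1\<rangle> X) = 0" by simp
  moreover have "Jm\<langle>1\<rangle> (Jp\<langle>-1\<rangle> X) = - X"
    using current_current_commutator[OF wt_J(2,1), of 1 1 "-1" X] Jm_Jp charge hw
      vs.scale_left_distrib[of 1 1 X]
    by simp
  ultimately show "X = 0" by simp
qed

lemma odd_odd_weight:
  assumes X: "X \<in> wt V (3/2)" and Y: "Y \<in> wt V (3/2)"
  shows "X\<langle>n\<rangle> Y \<in> wt V (2 - of_int n)" "n \<ge> 3 \<Longrightarrow> X\<langle>n\<rangle> Y = 0"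
proof -
  show "X\<langle>n\<rangle> Y \<in> wt V (2 - of_int n)"
    using mode_weight[OF wt_32_D[OF X] Y, of n] by simp
  then show "X\<langle>n\<rangle> Y = 0" if "n \<ge> 3"
    using that wt_negative[of "2 - of_int n"] by auto
qed

text \<open>
  The products at mode \<open>2\<close> follow from those at mode \<open>1\<close> by \<open>J\<^sup>0(1)\<close>. At mode \<open>0\<close> the square of the
  highest weight vector vanishes by level one; skew-symmetry then makes \<open>P(0)M\<close> symmetric, while
  lowering \<open>P(0)P = 0\<close> makes it antisymmetric.
\<close>
lemma null_doublet:
  assumes wt: "P \<in> wt V (3/2)" "M \<in> wt V (3/2)"
    and act: "J0\<langle>0\<rangle> P = P" "J0\<langle>0\<rangle> M = - M" "Jm\<langle>0\<rangle> P = M" "Jm\<langle>0\<rangle> M = 0"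
    and null: "\<And>X Y. X \<in> {P, M} \<Longrightarrow> Y \<in> {P, M} \<Longrightarrow> X\<langle>1\<rangle> Y = 0"
    and XY: "X \<in> {P, M}" "Y \<in> {P, M}" and n: "n \<ge> 0"
  shows "X\<langle>n\<rangle> Y = 0"
proof -
  have PM: "X \<in> wt V (3/2)" if "X \<in> {P, M}" for X using that wt by auto
  have two: "X\<langle>2\<rangle> Y = 0" if XY: "X \<in> {P, M}" "Y \<in> {P, M}" for X Y
  proof -
    have "(J0\<langle>0\<rangle> X)\<langle>2\<rangle> Y = 0"
      using current_doublet_commutator[OF wt_J(3) PM[OF XY(1)], of 1 1 Y] null[OF XY]
        current_doublet(1)[OF wt_J(3) PM[OF XY(2)], of 1] by simp
    then show ?thesis using XY(1) act by auto
  qed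
  have PP: "P\<langle>0\<rangle> P = 0"
  proof (rule charge_two_vanishes)
    show "P\<langle>0\<rangle> P \<in> wt V 2" using odd_odd_weight(1)[OF wt(1,1), of 0] by simp
    show "J0\<langle>0\<rangle> (P\<langle>0\<rangle> P) = smult V 2 (P\<langle>0\<rangle> P)"
      using current_doublet_commutator[OF wt_J(3) wt(1), of 0 0 P] act vs.scale_left_distrib[of 1 1]
      by simp
    show "Jm\<langle>1\<rangle> (P\<langle>0\<rangle> P) = 0"
      using current_doublet_commutator[OF wt_J(2) wt(1), of 1 0 P] act null[of M P]
        current_doublet(1)[OF wt_J(2) wt(1), of 1] by simp
  qed
  have high: "X\<langle>1 + int j\<rangle> Y = 0" if "X \<in> {P, M}" "Y \<in> {P, M}" for X Y j
  proof -
    consider "1 + int j = 1" | "1 + int j = 2" | "1 + int j \<ge> 3" by linarith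
    then show ?thesis
      by cases (use null two that odd_odd_weight(2)[OF PM PM] in auto)
  qed
  have "P\<langle>int j\<rangle> M = 0" if "1 \<le> j" for j
    using high[of P M "j - 1"] that by (simp add: of_nat_diff)
  then have sym: "M\<langle>0\<rangle> P = P\<langle>0\<rangle> M"
    using skew_symmetry[OF wt_32_D wt_32_D, OF wt, of 1 0] by (simp add: creation)
  have "P\<langle>0\<rangle> M + M\<langle>0\<rangle> P = 0"
    using current_doublet_commutator[OF wt_J(2) wt(1), of 0 0 P] act PP by simp
  then have PM0: "P\<langle>0\<rangle> M = 0" "M\<langle>0\<rangle> P = 0"
    using double_eq_0[of "P\<langle>0\<rangle> M"] unfolding sym by simp_all
  have "M\<langle>0\<rangle> M = 0"
    using current_doublet_commutator[OF wt_J(2) wt(1), of 0 0 M] act PM0 by simp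
  with PP PM0 XY have "X\<langle>0\<rangle> Y = 0" by auto
  with high[OF XY, of "nat (n - 1)"] n show ?thesis by (cases "n = 0") auto
qed

lemma G_G_null: "X \<in> {Gp, Gm} \<Longrightarrow> Y \<in> {Gp, Gm} \<Longrightarrow> n \<ge> 0 \<Longrightarrow> X\<langle>n\<rangle> Y = 0"
  by (rule null_doublet[OF wt_G J_G(1,2,5,6)]) (use G_G in auto)

lemma H_H_null:
  assumes "X \<in> {Hp, Hm}" "Y \<in> {Hp, Hm}" "n \<ge> 0"
  shows "X\<langle>n\<rangle> Y = 0"
proof -
  have *: "X\<langle>n\<rangle> Y = 0" if "X \<in> {Hp, - Hm}" "Y \<in> {Hp, - Hm}" for X Y
  proof (rule null_doublet[OF wt_H(1) wt_neg[OF wt_H(2)] _ _ _ _ _ that assms(3)])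
    show "X\<langle>1\<rangle> Y = 0" if "X \<in> {Hp, - Hm}" "Y \<in> {Hp, - Hm}" for X Y
      using that H_H[of Hp Hp] H_H[of Hp Hm] H_H[of Hm Hp] H_H[of Hm Hm] by auto
  qed (simp_all add: J_H)
  show ?thesis
    using assms(1,2) *[of Hp Hp] *[of Hp "- Hm"] *[of "- Hm" Hp] *[of "- Hm" "- Hm"] by auto
qed

lemma Gm_Hp: "Gm\<langle>1\<rangle> Hp = - J0"
proof -
  have eq: "- smult V 2 J0 = Gm\<langle>1\<rangle> Hp - J0"
    using current_doublet_commutator[OF wt_J(2) wt_G(1), of 0 1 Hp] J_G J_H Gp_Hp Gp_Hm Jm_Jp
    by (simp add: mode_scale_right)
  have "Gm\<langle>1\<rangle> Hp = - smult V 2 J0 + J0" unfolding eq by simp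
  then show ?thesis
    using vs.scale_left_distrib[of 1 1 J0] by simp
qed

lemma Gm_Hm: "Gm\<langle>1\<rangle> Hm = smult V 2 Jm"
  using current_doublet_commutator[OF wt_J(2) wt_G(1), of 0 1 Hm] J_G J_H Gp_Hm Jm_J0 by simp

text \<open>Apply \<open>J\<^sup>0(1)\<close> to the products at mode \<open>1\<close>.\<close>
lemma G_H_two:
  "Gp\<langle>2\<rangle> Hp = 0" "Gp\<langle>2\<rangle> Hm = smult V 2 \<one>" "Gm\<langle>2\<rangle> Hp = smult V 2 \<one>" "Gm\<langle>2\<rangle> Hm = 0"
  using current_doublet_commutator[OF wt_J(3) wt_G(1), of 1 1 Hp]
    current_doublet_commutator[OF wt_J(3) wt_G(1), of 1 1 Hm]
    current_doublet_commutator[OF wt_J(3) wt_G(2), of 1 1 Hp]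
    current_doublet_commutator[OF wt_J(3) wt_G(2), of 1 1 Hm]
    current_doublet(1)[OF wt_J(3) wt_H(1), of 1] current_doublet(1)[OF wt_J(3) wt_H(2), of 1]
    J_G J_J J0_Jpm Gp_Hp Gp_Hm Gm_Hp Gm_Hm
  by (simp_all add: mode_scale_right)

text \<open>The difference of the two sides has charge two and is killed by \<open>J\<^sup>-(1)\<close>.\<close>
lemma Gp_Hp_zero: "Gp\<langle>0\<rangle> Hp = T Jp"
proof -
  have "Gp\<langle>0\<rangle> Hp - T Jp = 0"
  proof (rule charge_two_vanishes)
    have "T Jp \<in> wt V 2" using mode_weight[OF wt_1_D(1)[OF wt_J(1)] vac_wt, of "-2"] by simp
    then show "Gp\<langle>0\<rangle> Hp - T Jp \<in> wt V 2"
      using odd_odd_weight(1)[OF wt_G(1) wt_H(1), of 0] by (simp add: wt_diff)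
    show "J0\<langle>0\<rangle> (Gp\<langle>0\<rangle> Hp - T Jp) = smult V 2 (Gp\<langle>0\<rangle> Hp - T Jp)"
      using current_doublet_commutator[OF wt_J(3) wt_G(1), of 0 0 Hp] J_G J_H J_J
        zero_mode_T[OF wt_1_D(1)[OF wt_J(3)], of Jp] vs.scale_left_distrib[of 1 1]
      by (simp add: mode_diff_right mode_scale_left vs.scale_right_diff_distrib)
    show "Jm\<langle>1\<rangle> (Gp\<langle>0\<rangle> Hp - T Jp) = 0"
      using current_doublet_commutator[OF wt_J(2) wt_G(1), of 1 0 Hp] J_G
        current_doublet(1)[OF wt_J(2) wt_H(1), of 1] Gm_Hp
        mode_T[OF wt_1_D(1)[OF wt_J(2)], of 1 Jp] Jm_Jp
      by (simp add: mode_diff_right)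
  qed
  then show ?thesis by simp
qed

lemma Gm_Hp_zero: "Gm\<langle>0\<rangle> Hp = Gp\<langle>0\<rangle> Hm - T J0"
  using current_doublet_commutator[OF wt_J(2) wt_G(1), of 0 0 Hp] J_G J_H Gp_Hp_zero
    zero_mode_T[OF wt_1_D(1)[OF wt_J(2)], of Jp] Jm_Jp
  by (simp add: algebra_simps)

lemma Gm_Hm_zero: "Gm\<langle>0\<rangle> Hm = T Jm"
proof -
  have "Jm\<langle>0\<rangle> (Gp\<langle>0\<rangle> Hm) = Gm\<langle>0\<rangle> Hm"
    using current_doublet_commutator[OF wt_J(2) wt_G(1), of 0 0 Hm] J_G J_H by simp
  moreover have "Jm\<langle>0\<rangle> (Gm\<langle>0\<rangle> Hp) = - (Gm\<langle>0\<rangle> Hm)"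
    using current_doublet_commutator[OF wt_J(2) wt_G(2), of 0 0 Hp] J_G J_H by simp
  ultimately have "smult V 2 (Gm\<langle>0\<rangle> Hm) = smult V 2 (T Jm)"
    using zero_mode_T[OF wt_1_D(1)[OF wt_J(2)], of J0] Jm_J0 vs.scale_left_distrib[of 1 1 "Gm\<langle>0\<rangle> Hm"]
    unfolding Gm_Hp_zero by (simp add: mode_diff_right mode_scale_left algebra_simps)
  then show ?thesis by simp
qed

definition conformal :: 'v where
  "conformal = Gp\<langle>0\<rangle> Hm - smult V (1/2) (T J0)"

lemma conformal_symmetric: "conformal = smult V (1/2) (Gp\<langle>0\<rangle> Hm) + smult V (1/2) (Gm\<langle>0\<rangle> Hp)"
proof -
  have "smult V (1/2) (Gp\<langle>0\<rangle> Hm) + smult V (1/2) (Gp\<langle>0\<rangle> Hm) = Gp\<langle>0\<rangle> Hm"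
    by (simp flip: vs.scale_left_distrib)
  then show ?thesis
    by (simp add: conformal_def Gm_Hp_zero vs.scale_right_diff_distrib add_diff_eq)
qed

lemma wt_conformal: "conformal \<in> wt V 2"
proof -
  have "T J0 \<in> wt V 2" using mode_weight[OF wt_1_D(1)[OF wt_J(3)] vac_wt, of "-2"] by simp
  then show ?thesis
    using odd_odd_weight(1)[OF wt_G(1) wt_H(2), of 0] by (simp add: conformal_def wt_diff wt_scale)
qed

text \<open>
  Move \<open>G\<^sup>+(n)\<close> past \<open>G\<^sup>+(0)\<close> in \<open>G\<^sup>+(n)G\<^sup>+(0)H\<^sup>-\<close>; the two modes anticommute because all products
  of \<open>G\<^sup>+\<close> with itself vanish.
\<close>
lemma Gp_conformal:
  "Gp\<langle>0\<rangle> conformal = smult V (1/2) (T Gp)" "Gp\<langle>1\<rangle> conformal = smult V (3/2) Gp"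
proof -
  have anti: "Gp\<langle>m\<rangle> (Gp\<langle>n\<rangle> v) = - (Gp\<langle>n\<rangle> (Gp\<langle>m\<rangle> v))" for m n v
    using commutator[OF wt_32_D wt_32_D, OF wt_G(1,1), where N = 0 and m = m and n = n and w = v] G_G_null[of Gp Gp] by simp
  have J0: "Gp\<langle>0\<rangle> J0 = - Gp" "Gp\<langle>1\<rangle> J0 = 0"
    using current_doublet[OF wt_J(3) wt_G(1), of 1] J_G by simp_all
  have "Gp\<langle>0\<rangle> (Gp\<langle>0\<rangle> Hm) = 0"
    using anti[of 0 0 Hm] double_eq_0 by (metis add.right_inverse)
  then show "Gp\<langle>0\<rangle> conformal = smult V (1/2) (T Gp)"
    using zero_mode_T[OF wt_32_D[OF wt_G(1)], of J0] J0
    by (simp add: conformal_def mode_bilinear)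
  have "Gp\<langle>1\<rangle> conformal = Gp + smult V (1/2) Gp"
    unfolding conformal_def mode_diff_right mode_scale_right anti[of 1 0 Hm] Gp_Hm J0
      mode_T[OF wt_32_D[OF wt_G(1)], of 1 J0]
    by (simp add: J0)
  then show "Gp\<langle>1\<rangle> conformal = smult V (3/2) Gp"
    using vs.scale_left_distrib[of 1 "1/2" Gp] by simp
qed

lemma conformal_high:
  assumes "X \<in> wt V (3/2)" "n \<ge> 2"
  shows "conformal\<langle>n\<rangle> X = 0" "X\<langle>n\<rangle> conformal = 0"
proof -
  have "conformal\<langle>n\<rangle> X \<in> wt V (5/2 - of_int n)" "X\<langle>n\<rangle> conformal \<in> wt V (5/2 - of_int n)"
    using mode_weight[OF wt_2_D[OF wt_conformal] assms(1), of n]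
      mode_weight[OF wt_32_D[OF assms(1)] wt_conformal, of n] by simp_all
  moreover have "wt V (5/2 - of_int n) = {0}"
    using wt_half wt_negative[of "5/2 - of_int n"] assms(2) by (cases "n = 2") auto
  ultimately show "conformal\<langle>n\<rangle> X = 0" "X\<langle>n\<rangle> conformal = 0" by auto
qed

lemma primary_Gp: "primary V conformal (3/2) Gp"
proof -
  note skew = skew_symmetry[OF wt_32_D wt_2_D, OF wt_G(1) wt_conformal]
  have "conformal\<langle>0\<rangle> Gp = T Gp"
    using skew[of 2 0] conformal_high(2)[OF wt_G(1)] Gp_conformal
      vs.scale_left_diff_distrib[of "3/2" "1/2" "T Gp"]
    by (simp add: numeral_2_eq_2 creation mode_bilinear)
  moreover have "conformal\<langle>1\<rangle> Gp = smult V (3/2) Gp"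
    using skew[of 1 1] conformal_high(2)[OF wt_G(1)] Gp_conformal by (simp add: creation)
  ultimately show ?thesis
    using conformal_high(1)[OF wt_G(1)] by (simp add: primary_def)
qed

text \<open>\<open>J\<^sup>-(0)\<close> commutes with the modes of \<open>\<omega>\<close> and maps \<open>G\<^sup>+\<close> to \<open>G\<^sup>-\<close>.\<close>
lemma primary_Gm: "primary V conformal (3/2) Gm"
proof -
  have "Jm\<langle>0\<rangle> conformal = 0"
    using current_doublet_commutator[OF wt_J(2) wt_G(1), of 0 0 Hm] J_G J_H Gm_Hm_zero Jm_J0
      zero_mode_T[OF wt_1_D(1)[OF wt_J(2)], of J0]
    by (simp add: conformal_def mode_bilinear)
  then have "conformal\<langle>n\<rangle> Gm = Jm\<langle>0\<rangle> (conformal\<langle>n\<rangle> Gp)" for n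
    using zero_mode_commutator[OF wt_1_D(2)[OF wt_J(2)] wt_2_D[OF wt_conformal], of n Gp] J_G
    by simp
  then show ?thesis
    using primary_Gp zero_mode_T[OF wt_1_D(1)[OF wt_J(2)], of Gp] J_G
    by (simp add: primary_def mode_scale_right)
qed

text \<open>
  The roles of the two doublets are interchangeable, with the signs forced by their different
  normalisations. As \<open>\<omega>\<close> is preserved by the exchange, what holds for \<open>G\<^sup>\<plusminus>\<close> also holds for \<open>H\<^sup>\<plusminus>\<close>.
\<close>
lemma exchanged: "sl2_doublets V c Hp (- Hm) (- Gp) Gm Jp Jm J0"
proof unfold_locales
  note skew = skew_symmetry[OF wt_32_D wt_32_D]
  have "Gp\<langle>1 + int j\<rangle> Hp = 0" "Gm\<langle>1 + int j\<rangle> Hp = (if j = 1 then smult V 2 \<one> else 0)"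
    if "1 \<le> j" for j
    using that odd_odd_weight(2)[OF wt_G(1) wt_H(1), of "1 + int j"]
      odd_odd_weight(2)[OF wt_G(2) wt_H(1), of "1 + int j"] G_H_two
    by (cases "j = 1"; simp)+
  then have "Hp\<langle>1\<rangle> Gp = - smult V 2 Jp" "Hp\<langle>1\<rangle> Gm = J0"
    using skew[OF wt_G(1) wt_H(1), of 1 1] skew[OF wt_G(2) wt_H(1), of 2 1] Gp_Hp Gm_Hp G_H_two(3)
    by (simp_all add: creation numeral_2_eq_2 mode_bilinear vacuum)
  then show "Hp\<langle>1\<rangle> (- Gp) = smult V 2 Jp" "Hp\<langle>1\<rangle> Gm = J0" by simp_all
qed (use wt_negative wt_half charge_bound wt_J wt_G wt_H J_J J_G J_H G_G H_H in \<open>auto intro: wt_neg\<close>)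

lemma exchanged_conformal: "sl2_doublets.conformal V Hp Gm J0 = conformal"
proof -
  interpret ex: sl2_doublets V c Hp "- Hm" "- Gp" Gm Jp Jm J0 by (rule exchanged)
  have "Hp\<langle>0\<rangle> Gm = Gm\<langle>0\<rangle> Hp + T J0"
    using skew_symmetry[OF wt_32_D wt_32_D, OF wt_G(2) wt_H(1), of 3 0]
      odd_odd_weight(2)[OF wt_G(2) wt_H(1)] Gm_Hp G_H_two
    by (simp add: creation numeral_3_eq_3 mode_bilinear vacuum)
  then show ?thesis
    unfolding conformal_def ex.conformal_def Gm_Hp_zero by simp
qed

lemma primary_H: "primary V conformal (3/2) Hp" "primary V conformal (3/2) Hm"
proof -
  interpret ex: sl2_doublets V c Hp "- Hm" "- Gp" Gm Jp Jm J0 by (rule exchanged)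
  show "primary V conformal (3/2) Hp" using ex.primary_Gp by (simp add: exchanged_conformal)
  show "primary V conformal (3/2) Hm" using ex.primary_Gm by (simp add: exchanged_conformal primary_def)
qed

text \<open>
  For \<open>m \<ge> 2\<close> the state \<open>\<omega>(m)(G(1)H)\<close> is \<open>m/2 - 1\<close> times \<open>G(m)H\<close>. The coefficient vanishes at
  \<open>m = 2\<close>, and the state \<open>G(m)H\<close> has negative weight for \<open>m \<ge> 3\<close>.
\<close>
lemma primary_GH_product:
  assumes G: "G \<in> {Gp, Gm}" and H: "H \<in> {Hp, Hm}"
  shows "primary V conformal 1 (G\<langle>1\<rangle> H)"
proof -
  have wG: "G \<in> wt V (3/2)" and wH: "H \<in> wt V (3/2)" and pG: "primary V conformal (3/2) G"
    and pH: "primary V conformal (3/2) H"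
    using G H wt_G wt_H primary_Gp primary_Gm primary_H by auto
  have com: "conformal\<langle>m\<rangle> (G\<langle>1\<rangle> H) = G\<langle>1\<rangle> (conformal\<langle>m\<rangle> H) + smult V (of_int m / 2 - 1) (G\<langle>m\<rangle> H)" for m
    using primary_commutator[OF wt_conformal wt_32_D[OF wG] pG, of m 1 H] by (simp add: algebra_simps)
  have "conformal\<langle>0\<rangle> (G\<langle>1\<rangle> H) = T (G\<langle>1\<rangle> H)"
    using com[of 0] pH mode_T[OF wt_32_D[OF wG], of 1 H] by (simp add: primary_def)
  moreover have "conformal\<langle>1\<rangle> (G\<langle>1\<rangle> H) = G\<langle>1\<rangle> H"
    using com[of 1] pH vs.scale_left_diff_distrib[of "3/2" "1/2" "G\<langle>1\<rangle> H"]
    by (simp add: primary_def mode_scale_right)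
  moreover have "conformal\<langle>n\<rangle> (G\<langle>1\<rangle> H) = 0" if "n \<ge> 2" for n
    using com[of n] pH that odd_odd_weight(2)[OF wG wH, of n] by (cases "n = 2") (simp_all add: primary_def)
  ultimately show ?thesis by (simp add: primary_def)
qed

lemma primary_J: "primary V conformal 1 Jp" "primary V conformal 1 Jm" "primary V conformal 1 J0"
proof -
  show "primary V conformal 1 J0" using primary_GH_product[of Gp Hm] Gp_Hm by simp
  have "primary V conformal 1 (smult V (1/2) (smult V 2 Jp))"
    using primary_scale[OF primary_GH_product[of Gp Hp], of "1/2"] unfolding Gp_Hp by simp
  then show "primary V conformal 1 Jp" by simp
  have "primary V conformal 1 (smult V (1/2) (smult V 2 Jm))"
    using primary_scale[OF primary_GH_product[of Gm Hm], of "1/2"] unfolding Gm_Hm by simp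
  then show "primary V conformal 1 Jm" by simp
qed

text \<open>
  Let the modes of \<open>\<omega>\<close> act on \<open>\<omega> = G\<^sup>+(0)H\<^sup>- - (1/2) T J\<^sup>0\<close>. The central charge comes from
  \<open>\<omega>(3)\<omega> = (3/2) G\<^sup>+(2)H\<^sup>- = 3\<one>\<close>.
\<close>
lemma virasoro_conformal: "virasoro_element V 6 conformal"
proof -
  have com: "conformal\<langle>m\<rangle> (Gp\<langle>0\<rangle> Hm) = Gp\<langle>0\<rangle> (conformal\<langle>m\<rangle> Hm) + smult V (of_int m / 2) (Gp\<langle>m - 1\<rangle> Hm)" for m
    using primary_commutator[OF wt_conformal wt_32_D[OF wt_G(1)] primary_Gp, of m 0 Hm]
    by (simp add: algebra_simps)
  note TJ0 = mode_T[OF wt_2_D[OF wt_conformal], of _ J0]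
  note pH = primary_H(2)[unfolded primary_def] and pJ = primary_J(3)[unfolded primary_def]
  have d: "conformal\<langle>m\<rangle> conformal = Gp\<langle>0\<rangle> (conformal\<langle>m\<rangle> Hm) + smult V (of_int m / 2) (Gp\<langle>m - 1\<rangle> Hm)
     - smult V (1/2) (conformal\<langle>m\<rangle> (T J0))" for m
    using com[of m] unfolding conformal_def mode_diff_right mode_scale_right by simp
  have "T conformal = T (Gp\<langle>0\<rangle> Hm) - smult V (1/2) (T (T J0))"
    by (simp add: conformal_def mode_bilinear)
  then have "conformal\<langle>0\<rangle> conformal = T conformal"
    using d[of 0] TJ0[of 0] pH pJ mode_T[OF wt_32_D[OF wt_G(1)], of 0 Hm] by simp
  moreover have "smult V 2 conformal = smult V (3/2) (Gp\<langle>0\<rangle> Hm) + smult V (1/2) (Gp\<langle>0\<rangle> Hm) - T J0"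
    by (simp add: conformal_def vs.scale_right_diff_distrib flip: vs.scale_left_distrib)
  then have "conformal\<langle>1\<rangle> conformal = smult V 2 conformal"
    using d[of 1] TJ0[of 1] pH pJ vs.scale_right_distrib[of "1/2" "T J0" "T J0"]
      vs.scale_left_distrib[of "1/2" "1/2" "T J0"]
    by (simp add: mode_bilinear)
  moreover have "conformal\<langle>2\<rangle> conformal = 0"
    using d[of 2] TJ0[of 2] pH pJ Gp_Hm by (simp add: mode_bilinear)
  moreover have "conformal\<langle>3\<rangle> conformal = smult V 3 \<one>"
    using d[of 3] TJ0[of 3] pH pJ G_H_two by (simp add: mode_bilinear)
  moreover have "conformal\<langle>n\<rangle> conformal = 0" if "n \<ge> 4" for n
    using that by (intro mode_negative_weight[OF wt_2_D[OF wt_conformal] wt_conformal]) auto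
  ultimately show ?thesis by (simp add: virasoro_element_def)
qed

theorem N4_relations_doublets: "N4_relations V 6 Gp Gm Hp Hm Jp Jm J0 conformal"
proof -
  have JJ: "\<forall>n\<ge>1. J0\<langle>n\<rangle> Jp = 0" "\<forall>n\<ge>1. J0\<langle>n\<rangle> Jm = 0" "\<forall>n\<ge>2. J0\<langle>n\<rangle> J0 = 0" "\<forall>n\<ge>2. Jp\<langle>n\<rangle> Jm = 0"
  proof -
    have "n = 1 \<or> n \<ge> 2" if "n \<ge> 1" for n :: int using that by auto
    then show "\<forall>n\<ge>1. J0\<langle>n\<rangle> Jp = 0" "\<forall>n\<ge>1. J0\<langle>n\<rangle> Jm = 0" "\<forall>n\<ge>2. J0\<langle>n\<rangle> J0 = 0" "\<forall>n\<ge>2. Jp\<langle>n\<rangle> Jm = 0"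
      using J0_Jpm current_current_high wt_J by blast+
  qed
  have JG: "\<forall>J\<in>{Jp, Jm, J0}. \<forall>G\<in>{Gp, Gm, Hp, Hm}. \<forall>n\<ge>1. J\<langle>n\<rangle> G = 0"
    using current_doublet(1) wt_J wt_G wt_H by blast
  have GH: "\<forall>n\<ge>2. Gp\<langle>n\<rangle> Hp = 0" "\<forall>n\<ge>2. Gm\<langle>n\<rangle> Hm = 0" "\<forall>n\<ge>3. Gp\<langle>n\<rangle> Hm = 0" "\<forall>n\<ge>3. Gm\<langle>n\<rangle> Hp = 0"
  proof -
    have "n = 2 \<or> n \<ge> 3" if "n \<ge> 2" for n :: int using that by auto
    then show "\<forall>n\<ge>2. Gp\<langle>n\<rangle> Hp = 0" "\<forall>n\<ge>2. Gm\<langle>n\<rangle> Hm = 0" "\<forall>n\<ge>3. Gp\<langle>n\<rangle> Hm = 0" "\<forall>n\<ge>3. Gm\<langle>n\<rangle> Hp = 0"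
      using odd_odd_weight(2) wt_G wt_H G_H_two by blast+
  qed
  have "smult V (1/2) (T J0) + smult V (1/2) (T J0) = T J0"
    using vs.scale_left_distrib[of "1/2" "1/2" "T J0"] by simp
  then have w: "Gp\<langle>0\<rangle> Hm = conformal + smult V (1/2) (T J0)" "Gm\<langle>0\<rangle> Hp = conformal - smult V (1/2) (T J0)"
    by (simp_all add: conformal_def Gm_Hp_zero algebra_simps)
  show ?thesis
    unfolding N4_relations_def Let_def
    using virasoro_conformal primary_J primary_Gp primary_Gm primary_H J_J JJ Jp_Jm Jp_Jp Jm_Jm
      J_G J_H JG G_G_null H_H_null Gp_Hp_zero Gp_Hp GH Gm_Hm_zero Gm_Hm w Gp_Hm G_H_two Gm_Hp
    by auto
qed

end

section \<open>Diagonal operators and coordinates on \<open>sl\<^sub>2\<close>\<close>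

text \<open>
  An operator that is diagonal in a given basis, in possibly infinite dimension. It will be used
  for the charge operator \<open>J\<^sup>0(0)\<close> and for \<open>L(0)\<close>.
\<close>
locale diagonal_operator = vector_space scale
  for scale :: "'f::field \<Rightarrow> 'v::ab_group_add \<Rightarrow> 'v" +
  fixes D :: "'v \<Rightarrow> 'v" and bas :: "'v set" and d :: "'v \<Rightarrow> 'f"
  assumes independent_bas: "independent bas" and span_bas: "span bas = UNIV"
    and D_add: "D (x + y) = D x + D y" and D_scale: "D (scale a x) = scale a (D x)"
    and D_bas: "b \<in> bas \<Longrightarrow> D b = scale (d b) b"
begin

abbreviation coeff :: "'v \<Rightarrow> 'v \<Rightarrow> 'f" where "coeff \<equiv> representation bas"

lemma coeff_add: "coeff (x + y) b = coeff x b + coeff y b"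
  using representation_add[OF independent_bas, of y x] span_bas by (simp add: add.commute)

lemma coeff_scale: "coeff (scale a x) b = a * coeff x b"
  using representation_scale[OF independent_bas, of x a] span_bas by simp

lemma coeff_diff: "coeff (x - y) b = coeff x b - coeff y b"
  using representation_diff[OF independent_bas, of y x] span_bas by simp

lemma coeff_D: "coeff (D v) b = d b * coeff v b"
proof -
  have "v \<in> span bas" using span_bas by simp
  then show ?thesis
  proof (induction rule: span_induct_alt)
    case base
    have "D 0 = 0" using D_scale[of 0 0] by simp
    then show ?case by (simp add: representation_zero)
  next
    case (step a x y)
    then have "D (scale a x + y) = scale a (scale (d x) x) + D y"
      by (simp add: D_add D_scale D_bas)
    then show ?case
      using step representation_basis[OF independent_bas step(1)]
      by (auto simp: coeff_add coeff_scale distrib_left)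
  qed
qed

lemma coeff_eq_0: "(\<And>b. b \<in> bas \<Longrightarrow> coeff v b = 0) \<Longrightarrow> v = 0"
  using sum_nonzero_representation_eq[OF independent_bas, of v] span_bas
    representation_ne_zero[of bas v] by auto

lemma eigenvector_coeff: "D v = scale t v \<Longrightarrow> coeff v b \<noteq> 0 \<Longrightarrow> d b = t"
  using coeff_D[of v b] by (simp add: coeff_scale)

text \<open>A diagonal operator is semisimple: its kernel is its generalised kernel.\<close>
lemma D_D_eq_0: "D (D v) = 0 \<Longrightarrow> D v = 0"
  by (rule coeff_eq_0) (metis coeff_D mult_eq_0_iff representation_zero)

text \<open>
  Take a nonzero vector of the subspace with the fewest nonzero coefficients, and let \<open>t\<close> be the
  eigenvalue of one of the basis vectors that occur in it. Applying \<open>D - t\<close> keeps the vector in the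
  subspace and removes a coefficient, so the result must be zero.
\<close>
lemma invariant_subspace_eigenvector:
  assumes A: "subspace A" "\<And>v. v \<in> A \<Longrightarrow> D v \<in> A" and v: "v \<in> A" "v \<noteq> 0"
  obtains x b where "x \<in> A" "x \<noteq> 0" "b \<in> bas" "D x = scale (d b) x"
proof -
  let ?supp = "\<lambda>x. {b. coeff x b \<noteq> 0}"
  have fin: "finite (?supp x)" for x by (rule finite_representation)
  obtain x where x: "x \<in> A" "x \<noteq> 0" and min: "\<And>y. y \<in> A \<Longrightarrow> y \<noteq> 0 \<Longrightarrow> card (?supp x) \<le> card (?supp y)"
    using ex_has_least_nat[of "\<lambda>x. x \<in> A \<and> x \<noteq> 0" v "\<lambda>x. card (?supp x)"] v by blast
  obtain b where b: "coeff x b \<noteq> 0" using coeff_eq_0 x(2) by blast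
  have "D x - scale (d b) x = 0"
  proof (rule ccontr)
    assume "D x - scale (d b) x \<noteq> 0"
    moreover have "D x - scale (d b) x \<in> A"
      using A x by (intro subspace_diff subspace_scale) auto
    moreover have "?supp (D x - scale (d b) x) \<subset> ?supp x"
      using b by (auto simp: coeff_diff coeff_D coeff_scale)
    ultimately show False using min psubset_card_mono[OF fin] by (meson leD)
  qed
  then show ?thesis using that[of x b] x representation_ne_zero[OF b] by simp
qed

end

context super_voa
begin

text \<open>\<open>m a b c\<close> is the image of the matrix with rows \<open>(a, b)\<close> and \<open>(c, -a)\<close>.\<close>
lemma iso_sl2_coordinates:
  assumes "iso_sl2 V W"
  obtains m :: "complex \<Rightarrow> complex \<Rightarrow> complex \<Rightarrow> 'v" where
    "\<And>w. w \<in> W \<longleftrightarrow> (\<exists>a b c. w = m a b c)"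
    "\<And>a b c a' b' c'. m a b c = m a' b' c' \<longleftrightarrow> a = a' \<and> b = b' \<and> c = c'"
    "\<And>a b c a' b' c'. m a b c + m a' b' c' = m (a + a') (b + b') (c + c')"
    "\<And>r a b c. smult V r (m a b c) = m (r * a) (r * b) (r * c)"
    "\<And>a b c a' b' c'. (m a b c)\<langle>0\<rangle> (m a' b' c') = m (b * c' - c * b') (2 * (a * b' - b * a')) (2 * (c * a' - a * c'))"
proof -
  obtain \<phi> where bij: "bij_betw \<phi> sl2 W"
    and add: "\<And>X Y. X \<in> sl2 \<Longrightarrow> Y \<in> sl2 \<Longrightarrow> \<phi> (X + Y) = \<phi> X + \<phi> Y"
    and scale: "\<And>a X. X \<in> sl2 \<Longrightarrow> \<phi> (\<chi> i j. a * X $ i $ j) = smult V a (\<phi> X)"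
    and bracket: "\<And>X Y. X \<in> sl2 \<Longrightarrow> Y \<in> sl2 \<Longrightarrow> \<phi> (X ** Y - Y ** X) = (\<phi> X)\<langle>0\<rangle> (\<phi> Y)"
    using assms unfolding iso_sl2_def by blast
  define M :: "complex \<Rightarrow> complex \<Rightarrow> complex \<Rightarrow> complex^2^2"
    where "M a b c = vector [vector [a, b], vector [c, - a]]" for a b c
  have M: "M a b c \<in> sl2" for a b c
    by (simp add: M_def sl2_def trace_def sum_2)
  have M_ex: "\<exists>a b c. X = M a b c" if "X \<in> sl2" for X
  proof -
    have "X $ 2 $ 2 = - X $ 1 $ 1"
      using that by (simp add: sl2_def trace_def sum_2 eq_neg_iff_add_eq_0 add.commute)
    then have "X = M (X $ 1 $ 1) (X $ 1 $ 2) (X $ 2 $ 1)"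
      by (simp add: M_def vec_eq_iff forall_2)
    then show ?thesis by blast
  qed
  have inj: "M a b c = M a' b' c' \<longleftrightarrow> a = a' \<and> b = b' \<and> c = c'" for a b c a' b' c'
    by (auto simp: M_def vec_eq_iff forall_2)
  have M_add: "M a b c + M a' b' c' = M (a + a') (b + b') (c + c')" for a b c a' b' c'
    by (simp add: M_def vec_eq_iff forall_2)
  have M_scale: "(\<chi> i j. r * M a b c $ i $ j) = M (r * a) (r * b) (r * c)" for r a b c
    by (simp add: M_def vec_eq_iff forall_2)
  have M_bracket: "M a b c ** M a' b' c' - M a' b' c' ** M a b c
     = M (b * c' - c * b') (2 * (a * b' - b * a')) (2 * (c * a' - a * c'))" for a b c a' b' c'
    by (simp add: M_def vec_eq_iff forall_2 matrix_matrix_mult_def sum_2 algebra_simps)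
  show ?thesis
  proof (rule that[of "\<lambda>a b c. \<phi> (M a b c)"])
    show "w \<in> W \<longleftrightarrow> (\<exists>a b c. w = \<phi> (M a b c))" for w
      using bij M M_ex unfolding bij_betw_def by (metis (no_types, lifting) image_iff)
    show "\<phi> (M a b c) = \<phi> (M a' b' c') \<longleftrightarrow> a = a' \<and> b = b' \<and> c = c'" for a b c a' b' c'
      using bij M inj inj_on_eq_iff[of \<phi> sl2] by (auto simp: bij_betw_def)
    show "\<phi> (M a b c) + \<phi> (M a' b' c') = \<phi> (M (a + a') (b + b') (c + c'))" for a b c a' b' c'
      using add[OF M M] M_add by metis
    show "smult V r (\<phi> (M a b c)) = \<phi> (M (r * a) (r * b) (r * c))" for r a b c
      using scale[OF M] M_scale by metis
    show "(\<phi> (M a b c))\<langle>0\<rangle> (\<phi> (M a' b' c'))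
       = \<phi> (M (b * c' - c * b') (2 * (a * b' - b * a')) (2 * (c * a' - a * c')))" for a b c a' b' c'
      using bracket[OF M M] M_bracket by metis
  qed
qed

definition sl2_triple :: "'v set \<Rightarrow> 'v \<Rightarrow> 'v \<Rightarrow> 'v \<Rightarrow> bool" where
  "sl2_triple W E H F \<longleftrightarrow> {E, H, F} \<subseteq> W \<and> H \<noteq> 0 \<and>
     (\<forall>w\<in>W. \<exists>x y z. w = smult V x E + smult V y H + smult V z F) \<and>
     H\<langle>0\<rangle> E = smult V 2 E \<and> H\<langle>0\<rangle> F = smult V (-2) F \<and> H\<langle>0\<rangle> H = 0 \<and>
     E\<langle>0\<rangle> F = H \<and> F\<langle>0\<rangle> E = - H \<and> F\<langle>0\<rangle> H = smult V 2 F \<and> E\<langle>0\<rangle> H = smult V (-2) E"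

lemma sl2_triple_swap:
  assumes "sl2_triple W E H F" "vsubspace V W"
  shows "sl2_triple W F (- H) E"
proof -
  have "\<exists>x y z. w = smult V x F + smult V y (- H) + smult V z E"
    if "w = smult V x E + smult V y H + smult V z F" for w x y z
    using that by (intro exI[of _ z] exI[of _ "- y"] exI[of _ x]) (simp add: algebra_simps)
  then show ?thesis
    using assms by (auto simp: sl2_triple_def vs.subspace_neg)
qed

end

text \<open>
  A traceless matrix \<open>(a, b, c)\<close> of determinant \<open>-1\<close> has eigenvalues \<open>\<plusminus>1\<close>. With respect to its
  eigenvectors it becomes the standard middle element, and \<open>(x, y, z)\<close> and \<open>(x', y', z')\<close> are the
  standard raising and lowering elements. The last three equations expand an arbitrary \<open>(p, q, r)\<close>
  in the triple; the coefficients are the traces against the dual basis for the trace form. When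
  \<open>b = 0\<close> the eigenvectors are \<open>(2, c)\<close> and \<open>(0, 1)\<close>, otherwise they are \<open>(b, 1 - a)\<close> and
  \<open>(b, -1 - a)\<close>.
\<close>
lemma sl2_triple_coordinates:
  fixes a b c :: complex
  assumes norm: "a\<^sup>2 + b * c = 1" and nz: "b \<noteq> 0 \<or> b = 0 \<and> a = 1"
  obtains x y z x' y' z' where
    "b * z - c * y = 2 * x" "a * y - b * x = y" "c * x - a * z = z"
    "b * z' - c * y' = - 2 * x'" "a * y' - b * x' = - y'" "c * x' - a * z' = - z'"
    "y * z' - z * y' = a" "2 * (x * y' - y * x') = b" "2 * (z * x' - x * z') = c"
    "\<And>p q r. p = (2 * p * x' + q * z' + r * y') * x + (p * a + q * c / 2 + r * b / 2) * a
        + (2 * p * x + q * z + r * y) * x'"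
    "\<And>p q r. q = (2 * p * x' + q * z' + r * y') * y + (p * a + q * c / 2 + r * b / 2) * b
        + (2 * p * x + q * z + r * y) * y'"
    "\<And>p q r. r = (2 * p * x' + q * z' + r * y') * z + (p * a + q * c / 2 + r * b / 2) * c
        + (2 * p * x + q * z + r * y) * z'"
proof (cases "b = 0")
  case True
  then have "a = 1" using nz by simp
  show ?thesis
    by (rule that[where x = "- c" and y = 2 and z = "- c\<^sup>2 / 2" and x' = 0 and y' = 0 and z' = "1 / 2"])
      (simp_all add: True \<open>a = 1\<close> algebra_simps power2_eq_square)
next
  case False
  have c: "c = (1 - a\<^sup>2) / b" using norm False by (simp add: field_simps)
  show ?thesis
    by (rule that[where x = "(1 - a) / 2" and y = "- b / 2" and z = "(1 - a)\<^sup>2 / (2 * b)"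
        and x' = "(1 + a) / 2" and y' = "b / 2" and z' = "- (1 + a)\<^sup>2 / (2 * b)"])
      (use False in \<open>simp_all add: c field_simps power2_eq_square\<close>)
qed

section \<open>Recognising the currents and the doublets\<close>

text \<open>
  The consequences of a root that matter: a weight-one state whose zero mode is diagonal with
  integer eigenvalues, the charges, on a basis of homogeneous states, with charges bounded by
  weights.
\<close>
locale charged_svoa = super_voa V c for V :: "'v::ab_group_add svoa" (structure) and c +
  fixes J0 :: 'v and bas :: "'v set" and d :: "'v \<Rightarrow> int" and h :: "'v \<Rightarrow> real"
  assumes independent_basis: "\<not> module.dependent (smult V) bas"
    and span_basis: "vspan V bas = UNIV"
    and charge_basis: "b \<in> bas \<Longrightarrow> J0\<langle>0\<rangle> b = smult V (of_int (d b)) b"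
    and weight_basis: "b \<in> bas \<Longrightarrow> b \<in> wt V (h b)"
    and bound: "b \<in> bas \<Longrightarrow> (of_int (d b))\<^sup>2 \<le> 4 * h b"
    and gap: "b \<in> bas \<Longrightarrow> h b \<noteq> 1/2"
    and wt_J0: "J0 \<in> wt V 1" and J0_0_J0: "J0\<langle>0\<rangle> J0 = 0" and J0_1_J0: "J0\<langle>1\<rangle> J0 = smult V 2 \<one>"
begin

sublocale charge: diagonal_operator "smult V" "\<lambda>v. J0\<langle>0\<rangle> v" bas "\<lambda>b. of_int (d b)"
  by unfold_locales (simp_all add: independent_basis span_basis charge_basis mode_add_right mode_scale_right)

sublocale weight: diagonal_operator "smult V" "\<lambda>v. \<omega>\<langle>1\<rangle> v" bas "\<lambda>b. of_real (h b)"
  by unfold_locales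
    (simp_all add: independent_basis span_basis L0[OF weight_basis] mode_add_right mode_scale_right)

lemma weight_coeff: "v \<in> wt V k \<Longrightarrow> weight.coeff v b \<noteq> 0 \<Longrightarrow> h b = k"
  using weight.eigenvector_coeff[OF L0] by (metis of_real_eq_iff)

lemma nonzero_coeff:
  assumes "v \<in> wt V k" "v \<noteq> 0"
  obtains b where "b \<in> bas" "weight.coeff v b \<noteq> 0" "h b = k"
  using assms weight.coeff_eq_0 weight_coeff by metis

lemma charged_vector:
  assumes "v \<in> wt V k" "v \<noteq> 0" "J0\<langle>0\<rangle> v = smult V t v"
  obtains i :: int where "t = of_int i" "(of_int i)\<^sup>2 \<le> 4 * k"
  using assms nonzero_coeff charge.eigenvector_coeff bound by metis

lemma wt_negative: "k < 0 \<Longrightarrow> wt V k = {0}"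
proof -
  assume "k < 0"
  have "v = 0" if v: "v \<in> wt V k" for v
  proof (rule ccontr)
    assume "v \<noteq> 0"
    then obtain b where "b \<in> bas" "h b = k" using nonzero_coeff[OF v] by blast
    with bound[of b] \<open>k < 0\<close> zero_le_power2[of "of_int (d b) :: real"] show False by linarith
  qed
  then show ?thesis using wt_subspace vs.subspace_0 by blast
qed

lemma wt_half: "wt V (1/2) = {0}"
proof -
  have "v = 0" if "v \<in> wt V (1/2)" for v
    using nonzero_coeff[OF that] gap by blast
  then show ?thesis using wt_subspace vs.subspace_0 by blast
qed

lemma charge_bound:
  assumes "v \<in> wt V k" "J0\<langle>0\<rangle> v = smult V (of_real t) v" "4 * k < t\<^sup>2"
  shows "v = 0"
proof (rule ccontr)
  assume "v \<noteq> 0"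
  then obtain i :: int where "complex_of_real t = of_int i" "(of_int i)\<^sup>2 \<le> 4 * k"
    using charged_vector assms by metis
  moreover from this have "t = of_int i"
    by (metis of_real_eq_iff of_real_of_int_eq)
  ultimately show False using assms(3) by simp
qed

text \<open>A two-dimensional space has room for two eigenvalues only.\<close>
lemma eigenvectors_span:
  assumes A: "vsubspace V A" "vdim V A = 2" and xy: "x \<in> A" "y \<in> A" "x \<noteq> 0" "y \<noteq> 0"
    and eigen: "H\<langle>0\<rangle> x = smult V s x" "H\<langle>0\<rangle> y = smult V t y" "s \<noteq> t"
  shows "\<forall>z\<in>A. \<exists>a b. z = smult V a x + smult V b y"
    and "\<And>z r. z \<in> A \<Longrightarrow> H\<langle>0\<rangle> z = smult V r z \<Longrightarrow> r \<noteq> s \<Longrightarrow> r \<noteq> t \<Longrightarrow> z = 0"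
proof -
  have indep: "a = 0 \<and> b = 0" if "smult V a x + smult V b y = 0" for a b
  proof -
    have "smult V (a * s) x + smult V (b * t) y = 0"
      using arg_cong[OF that, of "\<lambda>v. H\<langle>0\<rangle> v"] by (simp add: mode_bilinear eigen)
    moreover have "smult V (a * s) x + smult V (b * s) y = 0"
      using arg_cong[OF that, of "smult V s"] by (simp add: vs.scale_right_distrib mult.commute)
    ultimately have "smult V (b * t) y = smult V (b * s) y"
      by (metis add_left_cancel)
    then have "b = 0" using xy eigen by (simp add: vs.scale_cancel_right)
    then show ?thesis using that xy by simp
  qed
  have ne: "x \<noteq> y" using eigen xy by (metis vs.scale_cancel_right)
  have indep_xy: "\<not> module.dependent (smult V) {x, y}"
  proof -
    have "x \<notin> vspan V {y}"
    proof
      assume "x \<in> vspan V {y}"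
      then obtain k where "x = smult V k y" by (auto simp: vs.span_singleton)
      then show False using indep[of 1 "- k"] by simp
    qed
    then show ?thesis using ne xy by (simp add: vs.independent_insert)
  qed
  have span: "z \<in> vspan V {x, y}" if "z \<in> A" for z
  proof (rule ccontr)
    assume z: "z \<notin> vspan V {x, y}"
    then have "\<not> module.dependent (smult V) {z, x, y}" "z \<notin> {x, y}"
      using indep_xy vs.independent_insertI vs.span_base by blast+
    moreover obtain K where K: "K \<subseteq> A" "A \<subseteq> vspan V K" "card K = 2"
      using vs.basis_exists[of A] A(2) by metis
    moreover have "finite K" using K(3) card.infinite by fastforce
    ultimately have "card {z, x, y} \<le> 2"
      using vs.independent_span_bound[of K "{z, x, y}"] xy that by auto
    then show False using \<open>z \<notin> {x, y}\<close> ne by simp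
  qed
  show A_span: "\<forall>z\<in>A. \<exists>a b. z = smult V a x + smult V b y"
  proof
    fix z assume "z \<in> A"
    then obtain a where "z - smult V a x \<in> vspan V {y}"
      using span vs.span_breakdown_eq by blast
    then obtain b where "z - smult V a x = smult V b y" by (auto simp: vs.span_singleton)
    then have "z = smult V a x + smult V b y" by (simp add: algebra_simps)
    then show "\<exists>a b. z = smult V a x + smult V b y" by blast
  qed
  show "z = 0" if z: "z \<in> A" "H\<langle>0\<rangle> z = smult V r z" "r \<noteq> s" "r \<noteq> t" for z r
  proof -
    obtain a b where ab: "z = smult V a x + smult V b y" using A_span z(1) by blast
    have "smult V (a * s) x + smult V (b * t) y = smult V (a * r) x + smult V (b * r) y"
      using z(2) unfolding ab by (simp add: mode_bilinear eigen vs.scale_right_distrib mult.commute)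
    then have "smult V (a * (s - r)) x + smult V (b * (t - r)) y = 0"
      by (simp add: right_diff_distrib vs.scale_left_diff_distrib algebra_simps)
    then have "a * (s - r) = 0 \<and> b * (t - r) = 0" by (rule indep)
    then show ?thesis using z(3,4) ab by simp
  qed
qed

text \<open>
  The classification of the two-dimensional irreducible module, with \<open>P\<close> its highest weight vector.
  An eigenvector of the middle element exists because it is proportional to the diagonal operator
  \<open>J\<^sup>0(0)\<close>; raising and lowering it leaves a two-dimensional space after at most one step.
\<close>
lemma vector_rep_doublet:
  assumes triple: "sl2_triple W E H F" and J0: "J0 \<in> W" "J0 = smult V \<mu> H" "\<mu> \<noteq> 0"
    and rep: "vector_rep V W A"
  obtains P where "P \<in> A" "P \<noteq> 0" "H\<langle>0\<rangle> P = P" "E\<langle>0\<rangle> P = 0"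
    "F\<langle>0\<rangle> P \<in> A" "H\<langle>0\<rangle> (F\<langle>0\<rangle> P) = - (F\<langle>0\<rangle> P)" "E\<langle>0\<rangle> (F\<langle>0\<rangle> P) = P" "F\<langle>0\<rangle> (F\<langle>0\<rangle> P) = 0"
    "\<forall>z\<in>A. \<exists>a b. z = smult V a P + smult V b (F\<langle>0\<rangle> P)"
proof -
  have lie: "lie_module V W A" and dim: "vdim V A = 2"
    and irred: "\<And>A'. A' \<subseteq> A \<Longrightarrow> lie_module V W A' \<Longrightarrow> A' = {0} \<or> A' = A"
    using rep unfolding vector_rep_def by blast+
  have A: "vsubspace V A" and act: "\<And>u a. u \<in> W \<Longrightarrow> a \<in> A \<Longrightarrow> u\<langle>0\<rangle> a \<in> A"
    and br: "\<And>u v a. u \<in> W \<Longrightarrow> v \<in> W \<Longrightarrow> a \<in> A \<Longrightarrow> (u\<langle>0\<rangle> v)\<langle>0\<rangle> a = u\<langle>0\<rangle> (v\<langle>0\<rangle> a) - v\<langle>0\<rangle> (u\<langle>0\<rangle> a)"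
    using lie unfolding lie_module_def by blast+
  have W: "E \<in> W" "H \<in> W" "F \<in> W" using triple by (auto simp: sl2_triple_def)
  have raise: "H\<langle>0\<rangle> (E\<langle>0\<rangle> v) = smult V (t + 2) (E\<langle>0\<rangle> v)" if "v \<in> A" "H\<langle>0\<rangle> v = smult V t v" for v t
    using br[OF W(2,1) that(1)] triple that(2)
    by (simp add: sl2_triple_def mode_bilinear vs.scale_left_distrib algebra_simps)
  have lower: "H\<langle>0\<rangle> (F\<langle>0\<rangle> v) = smult V (t - 2) (F\<langle>0\<rangle> v)" if "v \<in> A" "H\<langle>0\<rangle> v = smult V t v" for v t
    using br[OF W(2,3) that(1)] triple that(2)
    by (simp add: sl2_triple_def mode_bilinear vs.scale_left_diff_distrib algebra_simps)
  have EF: "E\<langle>0\<rangle> (F\<langle>0\<rangle> v) = F\<langle>0\<rangle> (E\<langle>0\<rangle> v) + H\<langle>0\<rangle> v" if "v \<in> A" for v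
    using br[OF W(1,3) that] triple by (simp add: sl2_triple_def)
  note two = eigenvectors_span[OF A dim]
  note \<mu> = J0(3)
  obtain x0 where "x0 \<in> A" "x0 \<noteq> 0"
  proof -
    have "A \<noteq> {0}" using dim vs.dim_le_card[of "{0}" "{}"] by auto
    then show ?thesis using that vs.subspace_0[OF A] by blast
  qed
  then obtain x b where x: "x \<in> A" "x \<noteq> 0" and J0x: "J0\<langle>0\<rangle> x = smult V (of_int (d b)) x"
    using charge.invariant_subspace_eigenvector[OF A act[OF J0(1)]] by blast
  (* the middle element acts on x by the charge divided by mu *)
  define s :: complex where "s = of_int (d b) / \<mu>"
  have "smult V \<mu> (H\<langle>0\<rangle> x) = smult V \<mu> (smult V s x)"
    using J0x \<mu> unfolding J0(2) s_def by (simp add: mode_scale_left)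
  then have Hx: "H\<langle>0\<rangle> x = smult V s x"
    using \<mu> vs.scale_cancel_left by blast
  obtain P t where P: "P \<in> A" "P \<noteq> 0" "H\<langle>0\<rangle> P = smult V t P" "E\<langle>0\<rangle> P = 0"
  proof (cases "E\<langle>0\<rangle> x = 0")
    case True
    then show ?thesis using that x Hx by blast
  next
    case False
    have Ex: "E\<langle>0\<rangle> x \<in> A" "H\<langle>0\<rangle> (E\<langle>0\<rangle> x) = smult V (s + 2) (E\<langle>0\<rangle> x)"
      using act W x raise Hx by blast+
    have "E\<langle>0\<rangle> (E\<langle>0\<rangle> x) = 0"
      by (rule two(2)[OF x(1) Ex(1) x(2) False Hx Ex(2) _ act[OF W(1) Ex(1)] raise[OF Ex]]) simp_all
    then show ?thesis using that Ex False by blast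
  qed
  define M where "M = F\<langle>0\<rangle> P"
  have M: "M \<in> A" "H\<langle>0\<rangle> M = smult V (t - 2) M"
    using act W P lower unfolding M_def by blast+
  have "M \<noteq> 0"
  proof
    assume "M = 0"
    have "vspan V {P} \<subseteq> A" using A P(1) by (simp add: vs.span_minimal)
    moreover have "lie_module V W (vspan V {P})"
      unfolding lie_module_def
    proof (intro conjI ballI)
      fix u a assume u: "u \<in> W" and a: "a \<in> vspan V {P}"
      obtain i j k where "u = smult V i E + smult V j H + smult V k F"
        using triple u unfolding sl2_triple_def by blast
      moreover obtain l where "a = smult V l P" using a by (auto simp: vs.span_singleton)
      ultimately have "u\<langle>0\<rangle> a = smult V (j * l * t) P"
        using P(3,4) \<open>M = 0\<close> by (simp add: mode_bilinear M_def ac_simps)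
      then show "u\<langle>0\<rangle> a \<in> vspan V {P}" by (auto simp: vs.span_singleton)
    qed (use calculation br in auto)
    ultimately consider "vspan V {P} = {0}" | "vspan V {P} = A" using irred by blast
    then show False
    proof cases
      case 1
      then show False using P(2) vs.span_base[of P "{P}"] by auto
    next
      case 2
      then show False using dim vs.dim_le_card[of A "{P}"] by auto
    qed
  qed
  have FM: "F\<langle>0\<rangle> M = 0"
    by (rule two(2)[OF P(1) M(1) P(2) \<open>M \<noteq> 0\<close> P(3) M(2) _ act[OF W(3) M(1)] lower[OF M]]) simp_all
  have EM: "E\<langle>0\<rangle> M = smult V t P"
    using EF[OF P(1)] P(3,4) by (simp add: M_def)
  have "smult V t M + smult V (t - 2) M = 0"
    using EF[OF M(1)] FM EM M(2) by (simp add: mode_bilinear M_def)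
  then have "smult V (t + (t - 2)) M = 0" by (simp only: vs.scale_left_distrib)
  then have "t = 1" using \<open>M \<noteq> 0\<close> by simp
  have "\<forall>z\<in>A. \<exists>a b. z = smult V a P + smult V b M"
    by (rule two(1)[OF P(1) M(1) P(2) \<open>M \<noteq> 0\<close> P(3) M(2)]) simp
  then show ?thesis
    using that[of P] P M EM FM \<open>t = 1\<close> by (simp add: M_def)
qed

text \<open>
  If \<open>J\<^sup>0\<close> were nilpotent then the state \<open>Y\<close> corresponding to its conjugate transpose would satisfy
  \<open>J\<^sup>0(0)J\<^sup>0(0)Y = - 2 \<tau> J\<^sup>0\<close>, where \<open>\<tau>\<close> is the trace of the product of the two matrices, hence
  positive, and \<open>J\<^sup>0(0)\<close> would not be semisimple. So \<open>J\<^sup>0 = \<mu> H\<close> for a triple \<open>E, H, F\<close>; the charges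
  \<open>2\<mu>\<close> of \<open>E\<close> and \<open>\<mu>\<close> of the highest weight vector of \<open>A\<close> leave only \<open>\<mu> = \<plusminus>1\<close>.
\<close>
lemma sl2_triple_with_J0:
  assumes iso: "iso_sl2 V W" and J0: "J0 \<in> W" and W: "vsubspace V W" "W \<subseteq> wt V 1"
    and A: "vector_rep V W A" "A \<subseteq> wt V (3/2)"
  obtains E F where "sl2_triple W E J0 F"
proof -
  obtain m where W_eq: "\<And>w. w \<in> W \<longleftrightarrow> (\<exists>a b c. w = m a b c)"
    and inj: "\<And>a b c a' b' c'. m a b c = m a' b' c' \<longleftrightarrow> a = a' \<and> b = b' \<and> c = c'"
    and add: "\<And>a b c a' b' c'. m a b c + m a' b' c' = m (a + a') (b + b') (c + c')"
    and scale: "\<And>r a b c. smult V r (m a b c) = m (r * a) (r * b) (r * c)"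
    and bracket: "\<And>a b c a' b' c'. (m a b c)\<langle>0\<rangle> (m a' b' c')
      = m (b * c' - c * b') (2 * (a * b' - b * a')) (2 * (c * a' - a * c'))"
  proof (rule iso_sl2_coordinates[OF iso], goal_cases)
    case (1 m)
    show ?case by (rule 1(1)[of m, OF 1(2-)])
  qed
  have m0: "m 0 0 0 = 0" using scale[of 0 0 0 0] by simp
  have m_eq_0: "m p q r = 0 \<longleftrightarrow> p = 0 \<and> q = 0 \<and> r = 0" for p q r
    using inj[of p q r 0 0 0] m0 by simp
  obtain a b c where J0_eq: "J0 = m a b c" using iffD1[OF W_eq J0] by blast
  have "\<one> \<noteq> 0"
  proof
    assume "\<one> = 0"
    then have "m 1 0 0 = 0" using vacuum[of "-1" "m 1 0 0"] by (simp only: mode_zero_left) simp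
    then show False by (simp add: m_eq_0)
  qed
  have "J0 \<noteq> 0"
  proof
    assume "J0 = 0"
    then have "smult V 2 \<one> = 0" using J0_1_J0 by (simp only: mode_zero_left)
    then show False using \<open>\<one> \<noteq> 0\<close> by simp
  qed
  have abc: "\<not> (a = 0 \<and> b = 0 \<and> c = 0)" using \<open>J0 \<noteq> 0\<close> unfolding J0_eq m_eq_0 .
  have det: "a\<^sup>2 + b * c \<noteq> 0"
  proof
    assume nil: "a\<^sup>2 + b * c = 0"
    (* the conjugate transpose of the matrix of J0 *)
    define Y where "Y = m (cnj a) (cnj c) (cnj b)"
    define \<tau> where "\<tau> = 2 * a * cnj a + b * cnj b + c * cnj c"
    have "\<tau> = of_real (2 * (cmod a)\<^sup>2 + (cmod b)\<^sup>2 + (cmod c)\<^sup>2)"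
      unfolding \<tau>_def of_real_add of_real_mult complex_norm_square by simp
    moreover have "2 * (cmod a)\<^sup>2 + (cmod b)\<^sup>2 + (cmod c)\<^sup>2 > 0"
    proof -
      have "(cmod a)\<^sup>2 > 0 \<or> (cmod b)\<^sup>2 > 0 \<or> (cmod c)\<^sup>2 > 0" using abc by auto
      then show ?thesis by (smt (verit) zero_le_power2)
    qed
    ultimately have \<tau>: "\<tau> \<noteq> 0"
      by (metis of_real_eq_0_iff less_irrefl)
    have DDY: "J0\<langle>0\<rangle> (J0\<langle>0\<rangle> Y) = smult V (- 2 * \<tau>) J0"
    proof -
      have "b * (2 * (c * cnj a - a * cnj b)) - c * (2 * (a * cnj c - b * cnj a)) = - 2 * \<tau> * a"
        "2 * (a * (2 * (a * cnj c - b * cnj a)) - b * (b * cnj b - c * cnj c)) = - 2 * \<tau> * b"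
        "2 * (c * (b * cnj b - c * cnj c) - a * (2 * (c * cnj a - a * cnj b))) = - 2 * \<tau> * c"
        using nil unfolding \<tau>_def by algebra+
      then show ?thesis unfolding J0_eq Y_def bracket scale by simp
    qed
    have "J0\<langle>0\<rangle> (J0\<langle>0\<rangle> (J0\<langle>0\<rangle> Y)) = 0"
      unfolding DDY mode_scale_right J0_0_J0 by simp
    then have "J0\<langle>0\<rangle> (J0\<langle>0\<rangle> Y) = 0" by (rule charge.D_D_eq_0)
    then show False using DDY \<tau> \<open>J0 \<noteq> 0\<close> by simp
  qed
  (* if b = 0, the choice mu = a normalises the diagonal entry to 1 *)
  obtain \<mu> a' b' c' where \<mu>: "\<mu> \<noteq> 0" "J0 = smult V \<mu> (m a' b' c')"
    and norm: "a'\<^sup>2 + b' * c' = 1" and nz: "b' \<noteq> 0 \<or> b' = 0 \<and> a' = 1"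
  proof (cases "b = 0")
    case True
    then have "a \<noteq> 0" using det by simp
    then show ?thesis
      using that[of a 1 0 "c / a"] True by (simp add: J0_eq scale)
  next
    case False
    define \<mu> where "\<mu> = csqrt (a\<^sup>2 + b * c)"
    have \<mu>: "\<mu>\<^sup>2 = a\<^sup>2 + b * c" "\<mu> \<noteq> 0" using det by (simp_all add: \<mu>_def)
    have "(a / \<mu>)\<^sup>2 + (b / \<mu>) * (c / \<mu>) = (a\<^sup>2 + b * c) / \<mu>\<^sup>2"
      by (simp add: power2_eq_square add_divide_distrib)
    also have "\<dots> = 1" using \<mu>(1) det by simp
    finally show ?thesis
      using that[of \<mu> "a / \<mu>" "b / \<mu>" "c / \<mu>"] \<mu>(2) False by (simp add: J0_eq scale)
  qed
  obtain x y z x' y' z' where e: "b' * z - c' * y = 2 * x" "a' * y - b' * x = y" "c' * x - a' * z = z"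
    and f: "b' * z' - c' * y' = - 2 * x'" "a' * y' - b' * x' = - y'" "c' * x' - a' * z' = - z'"
    and ef: "y * z' - z * y' = a'" "2 * (x * y' - y * x') = b'" "2 * (z * x' - x * z') = c'"
    and span: "\<And>p q r. p = (2 * p * x' + q * z' + r * y') * x + (p * a' + q * c' / 2 + r * b' / 2) * a'
        + (2 * p * x + q * z + r * y) * x'"
      "\<And>p q r. q = (2 * p * x' + q * z' + r * y') * y + (p * a' + q * c' / 2 + r * b' / 2) * b'
        + (2 * p * x + q * z + r * y) * y'"
      "\<And>p q r. r = (2 * p * x' + q * z' + r * y') * z + (p * a' + q * c' / 2 + r * b' / 2) * c'
        + (2 * p * x + q * z + r * y) * z'"
  proof (rule sl2_triple_coordinates[OF norm nz], goal_cases)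
    case 1
    show ?case by (rule 1(1)[OF 1(2-)])
  qed
  define E H F where "E = m x y z" and "H = m a' b' c'" and "F = m x' y' z'"
  have neg: "- m p q r = m (- p) (- q) (- r)" for p q r
    using scale[of "-1" p q r] by simp
  have anti: "u\<langle>0\<rangle> v = - (v\<langle>0\<rangle> u)" if "u \<in> W" "v \<in> W" for u v
    using that unfolding W_eq by (auto simp: bracket neg inj algebra_simps)
  have EHF: "E \<in> W" "H \<in> W" "F \<in> W" using W_eq by (auto simp: E_def H_def F_def)
  have HE: "H\<langle>0\<rangle> E = smult V 2 E" and HF: "H\<langle>0\<rangle> F = smult V (-2) F" and EF: "E\<langle>0\<rangle> F = H"
    unfolding E_def H_def F_def bracket scale e f ef by simp_all
  have triple: "sl2_triple W E H F"
    unfolding sl2_triple_def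
  proof (intro conjI ballI)
    show "{E, H, F} \<subseteq> W" using EHF by simp
    show "H \<noteq> 0" using nz by (auto simp: H_def m_eq_0)
    show "\<exists>i j k. w = smult V i E + smult V j H + smult V k F" if w: "w \<in> W" for w
    proof -
      obtain p q r where w_eq: "w = m p q r" using w W_eq by blast
      have "w = smult V (2 * p * x' + q * z' + r * y') E
          + smult V (p * a' + q * c' / 2 + r * b' / 2) H + smult V (2 * p * x + q * z + r * y) F"
        unfolding w_eq E_def H_def F_def scale add inj by (intro conjI span)
      then show ?thesis by blast
    qed
    show "H\<langle>0\<rangle> H = 0" by (simp add: H_def bracket m0)
  qed (simp_all add: HE HF EF anti[OF EHF(3,1)] anti[OF EHF(3,2)] anti[OF EHF(1,2)])
  have J0_H: "J0 = smult V \<mu> H" using \<mu>(2) by (simp add: H_def)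
  have "H \<noteq> 0" using nz by (auto simp: H_def m_eq_0)
  then have "E \<noteq> 0" using EF by auto
  moreover have "E \<in> wt V 1" using EHF W(2) by blast
  moreover have "J0\<langle>0\<rangle> E = smult V (2 * \<mu>) E"
    unfolding J0_H mode_scale_left HE by (simp add: mult.commute)
  ultimately obtain i :: int where i: "2 * \<mu> = of_int i" "(of_int i)\<^sup>2 \<le> (4 * 1 :: real)"
    using charged_vector[of E 1 "2 * \<mu>"] by blast
  obtain P where "P \<in> A" "P \<noteq> 0" "H\<langle>0\<rangle> P = P"
  proof (rule vector_rep_doublet[OF triple J0 J0_H \<mu>(1) A(1)], goal_cases)
    case 1
    show ?case by (rule 1(1)[OF 1(2-4)])
  qed
  moreover from this have "P \<in> wt V (3/2)" using A(2) by blast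
  moreover have "J0\<langle>0\<rangle> P = smult V \<mu> P"
    using calculation(3) unfolding J0_H mode_scale_left by simp
  ultimately obtain j :: int where j: "\<mu> = of_int j"
    using charged_vector[of P "3/2" \<mu>] by blast
  have ij: "i = 2 * j" using i(1) unfolding j by (metis of_int_eq_iff of_int_mult of_int_numeral)
  have "i\<^sup>2 \<le> 4" using i(2) by (simp flip: of_int_power)
  then have "j\<^sup>2 \<le> 1\<^sup>2" using ij by simp
  then have "\<bar>j\<bar> \<le> 1" by (metis abs_le_square_iff abs_one)
  moreover have "j \<noteq> 0" using \<mu>(1) j by auto
  ultimately consider "j = 1" | "j = -1" by linarith
  then show ?thesis
  proof cases
    case 1
    then have "J0 = H" unfolding J0_H j by simp
    show ?thesis by (rule that[of E F]) (unfold \<open>J0 = H\<close>, rule triple)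
  next
    case 2
    then have "J0 = - H" unfolding J0_H j by simp
    show ?thesis by (rule that[of F E]) (unfold \<open>J0 = - H\<close>, rule sl2_triple_swap[OF triple W(1)])
  qed
qed

text \<open>
  With \<open>P, M\<close> and \<open>Q, N\<close> the doublets of \<open>A\<close> and \<open>B\<close>, charge and equivariance force
  \<open>P(1)Q = - 2b J\<^sup>+\<close> and \<open>P(1)N = M(1)Q = b J\<^sup>0\<close> and \<open>M(1)N = 2b J\<^sup>-\<close> for a scalar \<open>b\<close>, which is nonzero
  since these products span \<open>W\<close>. Rescaling the second doublet by \<open>-1/b\<close> and changing the sign of its
  lower component gives the normalised products.
\<close>
theorem is_N4_generated:
  assumes S: "S \<subseteq> wt V (3/2)" and decomposition: "direct_sum V (vspan V S) A B"
    and A_rep: "vector_rep V (mode_prod V A 1 B) A" and B_rep: "vector_rep V (mode_prod V A 1 B) B"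
    and iso: "iso_sl2 V (mode_prod V A 1 B)"
    and null: "mode_prod V A 1 A = {0}" "mode_prod V B 1 B = {0}"
    and J0: "J0 \<in> mode_prod V A 1 B"
  shows "is_N4 V (generated V S) 6"
proof -
  define W where "W = mode_prod V A 1 B"
  note A_rep = A_rep[folded W_def] and B_rep = B_rep[folded W_def] and iso = iso[folded W_def]
    and J0 = J0[folded W_def]
  have A: "vsubspace V A" and B: "vsubspace V B"
    and span_S: "vspan V S = {a + b | a b. a \<in> A \<and> b \<in> B}"
    using decomposition unfolding direct_sum_def by auto
  have A_S: "A \<subseteq> vspan V S"
    unfolding span_S using vs.subspace_0[OF B] by force
  have B_S: "B \<subseteq> vspan V S"
    unfolding span_S using vs.subspace_0[OF A] by force
  have S_wt: "vspan V S \<subseteq> wt V (3/2)"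
    by (intro vs.span_minimal S wt_subspace)
  note A_wt = subset_trans[OF A_S S_wt] and B_wt = subset_trans[OF B_S S_wt]
  have AB: "u\<langle>1\<rangle> v \<in> W" if "u \<in> A" "v \<in> B" for u v
    unfolding W_def mode_prod_def using that by (intro vs.span_base) blast
  have W_sub: "vsubspace V W" by (simp add: W_def mode_prod_def)
  have W_wt: "W \<subseteq> wt V 1"
    unfolding W_def mode_prod_def
  proof (intro vs.span_minimal wt_subspace subsetI)
    fix x assume "x \<in> {u\<langle>1\<rangle> v | u v. u \<in> A \<and> v \<in> B}"
    then obtain u v where x: "x = u\<langle>1\<rangle> v" and "u \<in> A" "v \<in> B" by blast
    then have "u \<in> wt V (of_int 3 / 2)" "v \<in> wt V (3/2)" using A_wt B_wt by auto
    from mode_weight[OF this, of 1] show "x \<in> wt V 1" by (simp add: x)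
  qed
  obtain E F where triple: "sl2_triple W E J0 F"
    by (rule sl2_triple_with_J0[OF iso J0 W_sub W_wt A_rep A_wt])
  have J0_1: "J0 = smult V 1 J0" by simp
  note doublet = vector_rep_doublet[OF triple J0 J0_1 one_neq_zero]
  obtain P where P: "P \<in> A" "J0\<langle>0\<rangle> P = P" "E\<langle>0\<rangle> P = 0"
    "F\<langle>0\<rangle> P \<in> A" "J0\<langle>0\<rangle> (F\<langle>0\<rangle> P) = - (F\<langle>0\<rangle> P)" "E\<langle>0\<rangle> (F\<langle>0\<rangle> P) = P" "F\<langle>0\<rangle> (F\<langle>0\<rangle> P) = 0"
    and A_basis: "\<forall>z\<in>A. \<exists>a b. z = smult V a P + smult V b (F\<langle>0\<rangle> P)"
    using doublet[OF A_rep] by metis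
  obtain Q where Q: "Q \<in> B" "J0\<langle>0\<rangle> Q = Q" "E\<langle>0\<rangle> Q = 0"
    "F\<langle>0\<rangle> Q \<in> B" "J0\<langle>0\<rangle> (F\<langle>0\<rangle> Q) = - (F\<langle>0\<rangle> Q)" "E\<langle>0\<rangle> (F\<langle>0\<rangle> Q) = Q" "F\<langle>0\<rangle> (F\<langle>0\<rangle> Q) = 0"
    and B_basis: "\<forall>z\<in>B. \<exists>a b. z = smult V a Q + smult V b (F\<langle>0\<rangle> Q)"
    using doublet[OF B_rep] by metis
  define M N where "M = F\<langle>0\<rangle> P" and "N = F\<langle>0\<rangle> Q"
  note P = P[folded M_def] and A_basis = A_basis[folded M_def]
    and Q = Q[folded N_def] and B_basis = B_basis[folded N_def]
  have EF: "E \<in> W" "F \<in> W" "J0 \<noteq> 0" "J0\<langle>0\<rangle> E = smult V 2 E" "J0\<langle>0\<rangle> F = smult V (- 2) F"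
      "E\<langle>0\<rangle> F = J0" "F\<langle>0\<rangle> E = - J0" "F\<langle>0\<rangle> J0 = smult V 2 F"
    and W_basis: "\<forall>w\<in>W. \<exists>x y z. w = smult V x E + smult V y J0 + smult V z F"
    using triple unfolding sl2_triple_def by blast+
  have "F \<noteq> 0" using EF(3,6) by auto
  have charge_two: "\<exists>x. w = smult V x E" if w: "w \<in> W" "J0\<langle>0\<rangle> w = smult V 2 w" for w
  proof -
    obtain x y z where xyz: "w = smult V x E + smult V y J0 + smult V z F" using W_basis w(1) by blast
    have move: "- smult V (z * 2) F = smult V (y * 2) J0 + smult V (z * 2) F"
      using w(2) unfolding xyz by (simp add: mode_bilinear EF J0_0_J0 vs.scale_right_distrib mult.commute)
    have "smult V (y * 2) J0 + smult V (z * 4) F = (smult V (y * 2) J0 + smult V (z * 2) F) + smult V (z * 2) F"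
      using vs.scale_left_distrib[of "z * 2" "z * 2" F] by (simp add: add.assoc mult.commute)
    also have "\<dots> = 0" unfolding move[symmetric] by simp
    finally have eq: "smult V (y * 2) J0 + smult V (z * 4) F = 0" .
    have "smult V (z * 8) F = 0"
      using arg_cong[OF eq, of "\<lambda>v. J0\<langle>0\<rangle> v"] by (simp add: mode_bilinear EF J0_0_J0)
    then have "z = 0" using \<open>F \<noteq> 0\<close> by simp
    moreover from this have "y = 0" using eq EF(3) by simp
    ultimately show ?thesis using xyz by auto
  qed
  have charge_zero: "\<exists>y. w = smult V y J0" if w: "w \<in> W" "J0\<langle>0\<rangle> w = 0" for w
  proof -
    obtain x y z where xyz: "w = smult V x E + smult V y J0 + smult V z F" using W_basis w(1) by blast
    have eq: "smult V (x * 2) E - smult V (z * 2) F = 0"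
      using w(2) unfolding xyz by (simp add: mode_bilinear EF J0_0_J0)
    have "smult V (x * 4) E + smult V (z * 4) F = 0"
      using arg_cong[OF eq, of "\<lambda>v. J0\<langle>0\<rangle> v"] by (simp add: mode_bilinear EF J0_0_J0 mult.commute)
    moreover have "smult V (x * 4) E - smult V (z * 4) F = 0"
      using arg_cong[OF eq, of "smult V 2"] by (simp add: vs.scale_right_diff_distrib mult.commute)
    ultimately have "smult V (z * 4) F + smult V (z * 4) F = 0"
      by simp
    from double_eq_0[OF this] have "z = 0" using \<open>F \<noteq> 0\<close> by simp
    then show ?thesis using eq xyz by (intro exI[of _ y]) auto
  qed
  have derivation: "u\<langle>0\<rangle> (x\<langle>1\<rangle> y) = x\<langle>1\<rangle> (u\<langle>0\<rangle> y) + (u\<langle>0\<rangle> x)\<langle>1\<rangle> y" if "u \<in> W" "x \<in> A" for u x y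
    using zero_mode_commutator[of u 1 x 3 1 y] W_wt A_wt that by auto
  obtain a where a: "P\<langle>1\<rangle> Q = smult V a E"
    using charge_two[OF AB[OF P(1) Q(1)]] derivation[OF J0 P(1), of Q] P Q
      vs.scale_left_distrib[of 1 1 "P\<langle>1\<rangle> Q"] by auto
  obtain b where b: "P\<langle>1\<rangle> N = smult V b J0"
    using charge_zero[OF AB[OF P(1) Q(4)]] derivation[OF J0 P(1), of N] P Q by auto
  obtain b' where b': "M\<langle>1\<rangle> Q = smult V b' J0"
    using charge_zero[OF AB[OF P(4) Q(1)]] derivation[OF J0 P(4), of Q] P Q by auto
  have MN: "M\<langle>1\<rangle> N = smult V (b * 2) F" "M\<langle>1\<rangle> N = smult V (b' * 2) F"
    using derivation[OF EF(2) P(1), of N] derivation[OF EF(2) P(4), of Q] P Q b b' EF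
    by (simp_all add: mode_scale_right M_def N_def)
  then have "smult V (b * 2) F = smult V (b' * 2) F" by (rule trans[OF sym])
  then have bb': "b' = b" using \<open>F \<noteq> 0\<close> by (simp add: vs.scale_cancel_right)
  have "smult V (b + b') J0 = smult V (- a) J0"
    using derivation[OF EF(2) P(1), of Q] a b b' EF
    by (simp add: mode_scale_right vs.scale_left_distrib M_def N_def)
  then have "b + b' = - a" using EF(3) by (metis vs.scale_cancel_right)
  then have b_a: "a = - 2 * b" unfolding bb' by simp
  have b_nz: "b \<noteq> 0"
  proof
    assume "b = 0"
    have "W \<subseteq> {0}"
      unfolding W_def mode_prod_def
    proof (rule vs.span_minimal)
      show "{u\<langle>1\<rangle> v | u v. u \<in> A \<and> v \<in> B} \<subseteq> {0}"
      proof clarify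
        fix u v assume "u \<in> A" "v \<in> B"
        then obtain i j k l where "u = smult V i P + smult V j M" "v = smult V k Q + smult V l N"
          using A_basis B_basis by metis
        then show "u\<langle>1\<rangle> v = 0"
          using a b b' MN(1) bb' b_a \<open>b = 0\<close> by (simp add: mode_bilinear)
      qed
    qed simp
    then show False using J0 EF(3) by blast
  qed
  define r where "r = - 1 / b"
  have r: "r \<noteq> 0" "r * b = - 1" using b_nz by (simp_all add: r_def)
  have PM: "{P, M} \<subseteq> A" and QN: "{smult V r Q, - smult V r N} \<subseteq> B"
    using P Q vs.subspace_scale[OF B] vs.subspace_neg[OF B] by auto
  have null_A: "u\<langle>1\<rangle> v = 0" if "u \<in> A" "v \<in> A" for u v
    using null(1) vs.span_base[of "u\<langle>1\<rangle> v" "{u\<langle>1\<rangle> v | u v. u \<in> A \<and> v \<in> A}"] that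
    unfolding mode_prod_def by blast
  have null_B: "u\<langle>1\<rangle> v = 0" if "u \<in> B" "v \<in> B" for u v
    using null(2) vs.span_base[of "u\<langle>1\<rangle> v" "{u\<langle>1\<rangle> v | u v. u \<in> B \<and> v \<in> B}"] that
    unfolding mode_prod_def by blast
  interpret sl2_doublets V c P M "smult V r Q" "- smult V r N" E F J0
  proof
    show "wt V k = {0}" if "k < 0" for k using wt_negative that .
    show "wt V (1/2) = {0}" by (rule wt_half)
    show "v = 0" if "v \<in> wt V k" "J0\<langle>0\<rangle> v = smult V (complex_of_real t) v" "4 * k < t\<^sup>2" for v k t
      using charge_bound that .
    show "X\<langle>1\<rangle> Y = 0" if "X \<in> {P, M}" "Y \<in> {P, M}" for X Y
      using null_A PM that by blast
    show "X\<langle>1\<rangle> Y = 0" if "X \<in> {smult V r Q, - smult V r N}" "Y \<in> {smult V r Q, - smult V r N}" for X Y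
      using null_B QN that by blast
    show "E \<in> wt V 1" "F \<in> wt V 1" "J0 \<in> wt V 1" using EF W_wt wt_J0 by auto
    show "P \<in> wt V (3/2)" "M \<in> wt V (3/2)" "smult V r Q \<in> wt V (3/2)" "- smult V r N \<in> wt V (3/2)"
      using PM QN A_wt B_wt by auto
    show "J0\<langle>0\<rangle> E = smult V 2 E" "J0\<langle>0\<rangle> F = smult V (- 2) F" "E\<langle>0\<rangle> F = J0" "J0\<langle>0\<rangle> J0 = 0" "J0\<langle>1\<rangle> J0 = smult V 2 \<one>"
      using EF J0_0_J0 J0_1_J0 by simp_all
    show "J0\<langle>0\<rangle> P = P" "J0\<langle>0\<rangle> M = - M" "E\<langle>0\<rangle> P = 0" "E\<langle>0\<rangle> M = P" "F\<langle>0\<rangle> P = M" "F\<langle>0\<rangle> M = 0"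
      using P by (simp_all add: M_def)
    show "J0\<langle>0\<rangle> (smult V r Q) = smult V r Q" "J0\<langle>0\<rangle> (- smult V r N) = - (- smult V r N)"
      "E\<langle>0\<rangle> (smult V r Q) = 0" "E\<langle>0\<rangle> (- smult V r N) = - (smult V r Q)"
      "F\<langle>0\<rangle> (smult V r Q) = - (- smult V r N)" "F\<langle>0\<rangle> (- smult V r N) = 0"
      using Q by (simp_all add: mode_scale_right N_def)
    show "P\<langle>1\<rangle> (smult V r Q) = smult V 2 E"
    proof -
      have "r * (- 2 * b) = 2" using r(2) by algebra
      then show ?thesis by (simp only: mode_scale_right a b_a vs.scale_scale)
    qed
    show "P\<langle>1\<rangle> (- smult V r N) = J0"
      using r(2) by (simp add: mode_scale_right b)
  qed
  let ?G = "{P, M, smult V r Q, - smult V r N}"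
  have "?G \<subseteq> vspan V S" using PM QN A_S B_S by auto
  moreover have "S \<subseteq> vspan V ?G"
  proof
    fix s assume "s \<in> S"
    then have "s \<in> vspan V S" by (rule vs.span_base)
    then obtain u v where "s = u + v" "u \<in> A" "v \<in> B" unfolding span_S by blast
    then obtain i j k l where s: "s = (smult V i P + smult V j M) + (smult V k Q + smult V l N)"
      using A_basis B_basis by metis
    have Q_eq: "Q = smult V (1 / r) (smult V r Q)" and N_eq: "N = smult V (- 1 / r) (- smult V r N)"
      using r(1) by simp_all
    have "Q \<in> vspan V ?G" "N \<in> vspan V ?G"
      by (subst Q_eq, intro vs.span_scale vs.span_base, simp)
        (subst N_eq, intro vs.span_scale vs.span_base, simp)
    moreover have "P \<in> vspan V ?G" "M \<in> vspan V ?G" by (simp_all add: vs.span_base)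
    ultimately show "s \<in> vspan V ?G"
      unfolding s by (intro vs.span_add vs.span_scale)
  qed
  ultimately have gen: "generated V S = generated V ?G"
    by (intro subset_antisym generated_mono)
  have mem: "smult V t (X\<langle>n\<rangle> Y) \<in> generated V ?G" if "X \<in> ?G" "Y \<in> ?G" for t X Y n
    using mode_in_generated[OF that] generated_subspace vs.subspace_scale by blast
  have E_gen: "E \<in> generated V ?G" using mem[of P "smult V r Q" "1/2" 1] unfolding Gp_Hp by simp
  have F_gen: "F \<in> generated V ?G" using mem[of M "- smult V r N" "1/2" 1] unfolding Gm_Hm by simp
  have J0_gen: "J0 \<in> generated V ?G" using mem[of P "- smult V r N" 1 1] unfolding Gp_Hm by simp
  have "conformal \<in> generated V ?G"
    unfolding conformal_symmetric
    by (intro vs.subspace_add[OF generated_subspace] mem) simp_all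
  then have conformal: "conformal \<in> wt V 2 \<inter> generated V ?G" using wt_conformal by blast
  have currents: "{E, F, J0} \<subseteq> wt V 1 \<inter> generated V ?G"
    using wt_J E_gen F_gen J0_gen by blast
  have generators: "?G \<subseteq> wt V (3/2)" using wt_G wt_H by blast
  show ?thesis
    unfolding is_N4_def gen
    by (intro exI conjI) (rule generators, rule refl, rule currents, rule conformal,
        rule N4_relations_doublets)
qed

end

section \<open>Roots of positive-definite lattices\<close>

context lattice_svoa
begin

lemma label_weight: "(m, \<beta>) \<in> fock_labels L \<Longrightarrow> e m \<beta> \<in> wt V (label_wt m \<beta>)"
  unfolding wt_eq by (intro vs.span_base) auto

lemma hstate_mode: "(hstate V e \<alpha>)\<langle>n\<rangle> v = (\<Sum>i\<in>Basis. smult V (of_real (\<alpha> \<bullet> i)) ((e {#(i, 1)#} 0)\<langle>n\<rangle> v))"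
  by (simp add: hstate_def mode_sum_left mode_scale_left)

text \<open>The zero modes of the orthonormal currents read off the coordinates of \<open>\<beta>\<close>.\<close>
lemma hstate_charge:
  assumes "(m, \<beta>) \<in> fock_labels L"
  shows "(hstate V e \<alpha>)\<langle>0\<rangle> (e m \<beta>) = smult V (of_real (\<alpha> \<bullet> \<beta>)) (e m \<beta>)"
proof -
  have "(hstate V e \<alpha>)\<langle>0\<rangle> (e m \<beta>) = (\<Sum>i\<in>Basis. smult V (of_real ((\<alpha> \<bullet> i) * (\<beta> \<bullet> i))) (e m \<beta>))"
    unfolding hstate_mode by (intro sum.cong refl) (simp add: heisenberg_mode[OF _ assms] del: One_nat_def)
  also have "\<dots> = smult V (of_real (\<alpha> \<bullet> \<beta>)) (e m \<beta>)"
    by (subst (2) euclidean_inner) (simp add: vs.scale_sum_left)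
  finally show ?thesis .
qed

lemma hstate_weight:
  assumes "0 \<in> L"
  shows "hstate V e \<alpha> \<in> wt V 1"
  unfolding hstate_def
proof (intro vs.subspace_sum wt_subspace wt_scale)
  fix i :: 'a assume "i \<in> Basis"
  then have "({#(i, 1)#}, 0) \<in> fock_labels L" using assms by (simp add: fock_labels_def)
  from label_weight[OF this] show "e {#(i, 1)#} 0 \<in> wt V 1" by (simp add: label_wt_def)
qed

lemma hstate_hstate:
  assumes "0 \<in> L"
  shows "(hstate V e \<alpha>)\<langle>0\<rangle> (hstate V e \<beta>) = 0"
    and "(hstate V e \<alpha>)\<langle>1\<rangle> (hstate V e \<beta>) = smult V (of_real (\<alpha> \<bullet> \<beta>)) \<one>"
proof -
  have label: "({#(j, 1)#}, 0) \<in> fock_labels L" if "j \<in> Basis" for j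
    using that assms by (simp add: fock_labels_def)
  show "(hstate V e \<alpha>)\<langle>0\<rangle> (hstate V e \<beta>) = 0"
    unfolding hstate_def[of V e \<beta>] mode_sum_right mode_scale_right
    by (intro sum.neutral ballI) (simp add: hstate_charge label del: One_nat_def)
  have "(e {#(i, 1)#} 0)\<langle>1\<rangle> (e {#(j, 1)#} 0) = (if j = i then \<one> else 0)"
    if "i \<in> Basis" "j \<in> Basis" for i j
    using heisenberg_mode[OF that(1) label[OF that(2)], of 1] by (simp add: vac_eq)
  then have "(hstate V e \<alpha>)\<langle>1\<rangle> (hstate V e \<beta>)
      = (\<Sum>i\<in>Basis. \<Sum>j\<in>Basis. if j = i then smult V (of_real ((\<alpha> \<bullet> i) * (\<beta> \<bullet> j))) \<one> else 0)"
    unfolding hstate_mode unfolding hstate_def mode_sum_right mode_scale_right vs.scale_sum_right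
    by (intro sum.cong refl) simp
  also have "\<dots> = (\<Sum>i\<in>Basis. smult V (of_real ((\<alpha> \<bullet> i) * (\<beta> \<bullet> i))) \<one>)"
    by (simp add: sum.delta')
  also have "\<dots> = smult V (of_real (\<alpha> \<bullet> \<beta>)) \<one>"
    by (subst euclidean_inner) (simp add: vs.scale_sum_left)
  finally show "(hstate V e \<alpha>)\<langle>1\<rangle> (hstate V e \<beta>) = smult V (of_real (\<alpha> \<bullet> \<beta>)) \<one>" .
qed

text \<open>
  Cauchy-Schwarz gives \<open>(\<alpha>, \<beta>)\<^sup>2 \<le> 2 (\<beta>, \<beta>)\<close>, and \<open>(\<beta>, \<beta>)/2\<close> is the least weight in the sector of \<open>\<beta>\<close>.
\<close>
lemma root_charge_bound:
  assumes "\<alpha> \<bullet> \<alpha> = 2"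
  shows "(\<alpha> \<bullet> \<beta>)\<^sup>2 \<le> 4 * label_wt m \<beta>"
proof -
  define n where "n = real (\<Sum>x\<in>#m. snd x)"
  have "0 \<le> n" by (simp only: n_def of_nat_0_le_iff)
  then have "2 * (\<beta> \<bullet> \<beta>) \<le> 4 * label_wt m \<beta>" unfolding label_wt_def n_def[symmetric] by simp
  with Cauchy_Schwarz_ineq[of \<alpha> \<beta>, unfolded assms] show ?thesis by (rule order_trans)
qed

text \<open>A state of weight \<open>1/2\<close> would have to be \<open>e\<^sup>\<beta>\<close> for a lattice vector of norm one.\<close>
lemma label_wt_gap:
  assumes "min_norm L 2" "(m, \<beta>) \<in> fock_labels L"
  shows "label_wt m \<beta> \<noteq> 1/2"
proof (cases "m = {#}")
  case True
  have "\<beta> = 0 \<or> \<beta> \<bullet> \<beta> \<ge> 2" using assms by (auto simp: min_norm_def fock_labels_def)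
  then show ?thesis by (auto simp: label_wt_def True)
next
  case False
  then obtain x m' where m: "m = add_mset x m'" by (metis multiset_cases)
  then have "snd x \<ge> 1" using assms(2) by (auto simp: fock_labels_def)
  then have "1 \<le> (\<Sum>y\<in>#m. snd y)" by (simp add: m)
  moreover define n where "n = real (\<Sum>y\<in>#m. snd y)"
  ultimately have "1 \<le> n" by (simp only: n_def real_of_nat_ge_one_iff)
  moreover have "0 \<le> \<beta> \<bullet> \<beta>" by simp
  ultimately show ?thesis unfolding label_wt_def n_def[symmetric] by linarith
qed

lemma root_charged_svoa:
  assumes "0 \<in> L" "integral_lattice L" "min_norm L 2" "\<alpha> \<in> L" "\<alpha> \<bullet> \<alpha> = 2"
  shows "\<exists>bas d h. charged_svoa V (of_nat DIM('a)) (hstate V e \<alpha>) bas d h"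
proof -
  define label where "label = the_inv_into (fock_labels L) (case_prod e)"
  have label: "label (e m \<beta>) = (m, \<beta>)" if "(m, \<beta>) \<in> fock_labels L" for m \<beta>
    using the_inv_into_f_f[OF basis_inj that] by (simp add: label_def)
  define d where "d b = lip \<alpha> (snd (label b))" for b
  define h where "h b = case_prod label_wt (label b)" for b
  have lip: "of_int (lip \<alpha> \<beta>) = \<alpha> \<bullet> \<beta>" if "(m, \<beta>) \<in> fock_labels L" for m \<beta>
    using that assms(2,4) by (auto simp: integral_lattice_def fock_labels_def lip_def)
  have "charged_svoa V (of_nat DIM('a)) (hstate V e \<alpha>) (case_prod e ` fock_labels L) d h"
  proof unfold_locales
    fix b assume "b \<in> case_prod e ` fock_labels L"
    then obtain m \<beta> where m: "(m, \<beta>) \<in> fock_labels L" and b: "b = e m \<beta>" by auto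
    have d: "real_of_int (d b) = \<alpha> \<bullet> \<beta>" and h: "h b = label_wt m \<beta>"
      using lip[OF m] by (simp_all add: d_def h_def b label[OF m])
    show "(hstate V e \<alpha>)\<langle>0\<rangle> b = smult V (of_int (d b)) b"
      using hstate_charge[OF m, of \<alpha>] unfolding d[symmetric] b by simp
    show "b \<in> wt V (h b)" using label_weight[OF m] unfolding h unfolding b .
    show "(real_of_int (d b))\<^sup>2 \<le> 4 * h b" unfolding d h by (rule root_charge_bound[OF assms(5)])
    show "h b \<noteq> 1/2" unfolding h by (rule label_wt_gap[OF assms(3) m])
  qed (use basis_indep basis_span hstate_weight hstate_hstate assms in simp_all)
  then show ?thesis by blast
qed

end

theorem theorem2:
  fixes L :: "'a::euclidean_space set"
    and \<epsilon> :: "'a \<Rightarrow> 'a \<Rightarrow> complex"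
    and VL :: "'v::ab_group_add svoa"
    and e :: "('a \<times> nat) multiset \<Rightarrow> 'a \<Rightarrow> 'v"
    and S A B :: "'v set"
  assumes "pd_lattice L" "integral_lattice L" "odd_lattice L" "min_norm L 2"
    and "lattice_cocycle L \<epsilon>"
    and "lattice_svoa VL L \<epsilon> e"
    and generators: "S \<subseteq> wt VL (3/2)" "finite S" "card S = 4"
    and I: "direct_sum VL (vspan VL S) A B"
      "vector_rep VL (mode_prod VL A 1 B) A" "vector_rep VL (mode_prod VL A 1 B) B"
    and II: "iso_sl2 VL (mode_prod VL A 1 B)"
    and III: "mode_prod VL A 1 A = {0}" "mode_prod VL B 1 B = {0}"
    and IV: "\<exists>\<alpha>\<in>L. \<alpha> \<bullet> \<alpha> = 2 \<and> hstate VL e \<alpha> \<in> mode_prod VL A 1 B"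
  shows "is_N4 VL (generated VL S) 6"
proof -
  have "0 \<in> L"
    using \<open>pd_lattice L\<close> unfolding pd_lattice_def by (auto intro!: image_eqI[of _ _ "\<lambda>_. 0"])
  moreover obtain \<alpha> where \<alpha>: "\<alpha> \<in> L" "\<alpha> \<bullet> \<alpha> = 2" and J0: "hstate VL e \<alpha> \<in> mode_prod VL A 1 B"
    using IV by blast
  ultimately obtain bas d h where "charged_svoa VL (of_nat DIM('a)) (hstate VL e \<alpha>) bas d h"
    using lattice_svoa.root_charged_svoa[OF \<open>lattice_svoa VL L \<epsilon> e\<close>] \<open>integral_lattice L\<close> \<open>min_norm L 2\<close>
    by blast
  then show ?thesis
    by (rule charged_svoa.is_N4_generated[OF _ generators(1) I II III J0])
qed

end
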